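(* Let $S \subset \mathbb{R}$ be a finite set. For each $n \in \mathbb{N}$ let $P_n(z) = \sum_{j=0}^{n} a_{j,n} z^j$ be a polynomial with all coefficients $a_{0,n},\ldots,a_{n,n}$ in $S$ that is self-reciprocal, i.e. $a_{j,n} = a_{n-j,n}$ for $j=0,1,\ldots,n$. If $$\lim_{n \to \infty} |P_n(1)| = \infty,$$ then $$\lim_{n \to \infty} \mathrm{NZ}(P_n) = \infty.$$
   Context: $\mathbb{N}=\{1,2,3,\ldots\}$. $\mathrm{NZ}(P_n)$ denotes the number of zeros of the algebraic polynomial $P_n$ lying on the unit circle $\{z \in \mathbb{C}: |z|=1\}$, counted with multiplicities (with value $\infty$ if $P_n\equiv 0$). *)

theory Defs
  imports "HOL-Analysis.Analysis" "HOL-Computational_Algebra.Polynomial"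
begin

text \<open>For \<open>p = 0\<close> the sum would range over an infinite set and collapse to \<open>0\<close>.\<close>

definition NZ :: "complex poly \<Rightarrow> enat" where
  "NZ p = (if p = 0 then \<infinity>
           else enat (\<Sum>z | norm z = 1 \<and> poly p z = 0. order z p))"

definition self_reciprocal :: "nat \<Rightarrow> (nat \<Rightarrow> real) \<Rightarrow> bool" where
  "self_reciprocal n c \<longleftrightarrow> (\<forall>j\<le>n. c j = c (n - j))"

text \<open>The polynomial with coefficients \<open>c 0, \<dots>, c n\<close>; \<open>c n\<close> may vanish, so \<open>n\<close> only bounds the degree.\<close>

definition coeff_poly :: "nat \<Rightarrow> (nat \<Rightarrow> real) \<Rightarrow> complex poly" where
  "coeff_poly n c = (\<Sum>j\<le>n. monom (of_real (c j)) j)"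

end

theory Submission
  imports Defs
begin

text \<open>
  Suppose that infinitely many \<open>P n\<close> have at most \<open>k\<close> unimodular zeros, and let \<open>Q n\<close> be the monic
  polynomial whose zeros are these, with multiplicities. On the unit circle \<open>P n * Q n\<close> is a monomial
  times a nonnegative function, so its \<open>L\<^sup>1\<close> norm is the modulus of a single coefficient and hence
  bounded. Along a subsequence \<open>Q n\<close> tends to some \<open>Q\<close>. The coefficients of \<open>P n * Q\<close> lie in a fixed
  finite set, so those of \<open>P n * Q n\<close> are either bounded away from \<open>0\<close> or uniformly small; the test
  functions of Cohen and Davenport show that the number of large ones is bounded, because they have a
  bounded number of frequencies and so do not see the small coefficients. Hence \<open>P n * Q\<close> has boundedly
  many nonzero coefficients. Away from them the coefficients of \<open>P n\<close> obey a fixed linear recurrence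
  with values in a finite set and are periodic, so that \<open>(1 - z ^ p) * P n\<close> is sparse for a fixed \<open>p\<close>.

  If \<open>P n\<close> is large at \<open>1\<close>, then the frequencies of this sparse sum, measured from the centre of
  symmetry, can be separated at a scale \<open>\<mu>\<close> such that some cluster of frequencies far above \<open>\<mu>\<close> has
  nonzero coefficient sum. On an interval of length comparable to \<open>1 / \<mu>\<close> near \<open>0\<close> without a sign change,
  the correlation with that cluster is bounded by the integral of the sum itself, which is much smaller.
\<close>

subsection \<open>Averages over roots of unity\<close>

definition unity_root :: "nat \<Rightarrow> nat \<Rightarrow> complex" where
  "unity_root N j = cis (2 * pi * real j / real N)"

lemma norm_unity_root [simp]: "norm (unity_root N j) = 1"
  by (simp add: unity_root_def)

lemma sum_unity_root:
  assumes "a < N" "b < N"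
  shows "(\<Sum>j<N. unity_root N j ^ a * cnj (unity_root N j ^ b)) = (if a = b then of_nat N else 0)"
proof -
  define w where "w = cis (2 * pi * (real a - real b) / real N)"
  have N: "N > 0" using assms by simp
  have eq: "unity_root N j ^ a * cnj (unity_root N j ^ b) = w ^ j" for j
  proof -
    have "unity_root N j ^ a * cnj (unity_root N j ^ b)
        = cis (real a * (2 * pi * real j / real N)) * cis (- (real b * (2 * pi * real j / real N)))"
      by (simp only: unity_root_def complex_cnj_power cis_cnj Complex.DeMoivre mult_minus_right)
    also have "\<dots> = cis (real j * (2 * pi * (real a - real b) / real N))"
      unfolding cis_mult by (rule arg_cong[where f = cis]) (simp add: algebra_simps diff_divide_distrib)
    finally show ?thesis by (simp add: w_def Complex.DeMoivre)
  qed
  show ?thesis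
  proof (cases "a = b")
    case True
    then show ?thesis unfolding eq by (simp add: w_def)
  next
    case False
    have "w \<noteq> 1"
    proof
      assume "w = 1"
      then have "cos (2 * pi * (real a - real b) / real N) = 1"
        by (simp add: w_def complex_eq_iff)
      then obtain m :: int where "2 * pi * (real a - real b) / real N = of_int m * 2 * pi"
        unfolding cos_one_2pi_int by blast
      then have "(2 * pi) * (real a - real b) = (2 * pi) * (of_int m * real N)"
        using N by (simp add: field_simps)
      then have "real a - real b = of_int m * real N"
        by (subst (asm) mult_cancel_left) simp
      then have "of_int (int a - int b) = (of_int (m * int N) :: real)" by simp
      then have *: "int a - int b = m * int N" by (simp only: of_int_eq_iff)
      then have "int N dvd int a - int b" by simp
      then have "int a mod int N = int b mod int N" by (simp add: mod_eq_dvd_iff)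
      then show False using assms False by simp
    qed
    moreover have "w ^ N = 1"
    proof -
      have "w ^ N = cis (2 * pi * of_int (int a - int b))"
        using N by (simp add: w_def Complex.DeMoivre)
      also have "\<dots> = 1" by (rule cis_multiple_2pi) simp
      finally show ?thesis .
    qed
    ultimately show ?thesis
      using False unfolding eq by (simp add: sum_gp_strict)
  qed
qed

text \<open>Discrete Parseval identity: once \<open>N\<close> exceeds both degrees, averaging over
  the \<open>N\<close>-th roots of unity is exact, so integrals over the circle can be replaced by
  finite sums.\<close>

lemma sum_unity_root_poly:
  fixes F \<phi> :: "complex poly"
  assumes "degree F < N" "degree \<phi> < N"
  shows "(\<Sum>j<N. poly F (unity_root N j) * cnj (poly \<phi> (unity_root N j)))
       = of_nat N * (\<Sum>i<N. coeff F i * cnj (coeff \<phi> i))"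
proof -
  have exp: "poly p z = (\<Sum>i<N. coeff p i * z ^ i)" if "degree p < N" for p :: "complex poly" and z
    unfolding poly_altdef by (rule sum.mono_neutral_left) (use that in \<open>auto simp: coeff_eq_0\<close>)
  have "(\<Sum>j<N. poly F (unity_root N j) * cnj (poly \<phi> (unity_root N j)))
     = (\<Sum>j<N. \<Sum>a<N. \<Sum>b<N. coeff F a * cnj (coeff \<phi> b) * (unity_root N j ^ a * cnj (unity_root N j ^ b)))"
    by (simp add: exp assms sum_product cnj_sum mult_ac)
  also have "\<dots> = (\<Sum>a<N. \<Sum>b<N. coeff F a * cnj (coeff \<phi> b) * (\<Sum>j<N. unity_root N j ^ a * cnj (unity_root N j ^ b)))"
    by (subst sum.swap, rule sum.cong[OF refl], subst sum.swap) (simp add: sum_distrib_left)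
  also have "\<dots> = (\<Sum>a<N. \<Sum>b<N. if a = b then of_nat N * (coeff F a * cnj (coeff \<phi> b)) else 0)"
    by (intro sum.cong refl) (simp only: sum_unity_root lessThan_iff, simp)
  also have "\<dots> = of_nat N * (\<Sum>i<N. coeff F i * cnj (coeff \<phi> i))"
    by (simp add: sum_distrib_left)
  finally show ?thesis .
qed

text \<open>By the phase hypothesis \<open>cnj \<kappa> * F * cnj (z ^ M)\<close> equals the modulus
  of \<open>F\<close> pointwise, so the mean of that modulus is the modulus of the single
  coefficient at \<open>M\<close>. The pairing with \<open>\<phi>\<close> is then at most this mean
  times the supremum of \<open>\<phi>\<close>.\<close>

lemma pairing_bound:
  fixes F \<phi> :: "complex poly"
  assumes "\<And>z. norm z = 1 \<Longrightarrow> norm (poly \<phi> z) \<le> B"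
    and F: "\<And>z. norm z = 1 \<Longrightarrow> poly F z = \<kappa> * z ^ M * of_real (norm (poly F z))"
    and "norm \<kappa> = 1" and N: "degree F < N" "degree \<phi> < N"
  shows "norm (\<Sum>i<N. coeff F i * cnj (coeff \<phi> i)) \<le> B * norm (coeff F M)"
proof -
  \<comment> \<open>The number of sample points also has to exceed \<open>M\<close>, because
    \<open>F\<close> is paired with the monomial of degree \<open>M\<close>.\<close>
  define L where "L = Suc (N + M)"
  have ext: "(\<Sum>i<N. coeff F i * cnj (coeff \<phi> i)) = (\<Sum>i<L. coeff F i * cnj (coeff \<phi> i))"
    by (rule sum.mono_neutral_left) (use N in \<open>auto simp: L_def coeff_eq_0\<close>)
  have L: "L > 0" by (simp add: L_def)
  have "(\<Sum>j<L. norm (poly F (unity_root L j)))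
      = norm (cnj \<kappa> * (\<Sum>j<L. poly F (unity_root L j) * cnj (poly (monom 1 M) (unity_root L j))))"
  proof -
    have "cnj \<kappa> * (poly F z * cnj (poly (monom 1 M) z)) = of_real (norm (poly F z))" if "norm z = 1" for z
    proof -
      have "cnj \<kappa> * (poly F z * cnj (z ^ M))
         = (cnj \<kappa> * \<kappa>) * (z ^ M * cnj (z ^ M)) * of_real (norm (poly F z))"
        by (subst F[OF that]) (simp add: mult_ac)
      also have "\<dots> = of_real (norm (poly F z))"
        using that \<open>norm \<kappa> = 1\<close> by (simp add: complex_norm_square[symmetric] mult.commute[of "cnj \<kappa>"] norm_power del: complex_cnj_power)
      finally show ?thesis by (simp add: poly_monom)
    qed
    then have "cnj \<kappa> * (\<Sum>j<L. poly F (unity_root L j) * cnj (poly (monom 1 M) (unity_root L j)))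
        = of_real (\<Sum>j<L. norm (poly F (unity_root L j)))"
      by (simp add: sum_distrib_left)
    then show ?thesis by (simp add: sum_nonneg del: of_real_sum)
  qed
  also have "\<dots> = real L * norm (coeff F M)"
  proof -
    have "degree (monom (1::complex) M) < L" by (simp add: degree_monom_eq L_def)
    moreover have "degree F < L" using N by (simp add: L_def)
    moreover have "(\<Sum>i<L. coeff F i * cnj (coeff (monom 1 M) i)) = coeff F M"
    proof -
      have "(\<Sum>i<L. coeff F i * cnj (coeff (monom 1 M) i)) = (\<Sum>i<L. if i = M then coeff F i else 0)"
        by (rule sum.cong) auto
      also have "\<dots> = coeff F M" by (simp add: L_def)
      finally show ?thesis .
    qed
    ultimately show ?thesis
      by (simp only: sum_unity_root_poly norm_mult) (simp add: \<open>norm \<kappa> = 1\<close>)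
  qed
  finally have tot: "(\<Sum>j<L. norm (poly F (unity_root L j))) = real L * norm (coeff F M)" .
  have "real L * norm (\<Sum>i<L. coeff F i * cnj (coeff \<phi> i))
      = norm (\<Sum>j<L. poly F (unity_root L j) * cnj (poly \<phi> (unity_root L j)))"
    using N by (subst sum_unity_root_poly) (auto simp: L_def norm_mult simp del: of_nat_Suc)
  also have "\<dots> \<le> (\<Sum>j<L. norm (poly F (unity_root L j)) * B)"
    by (rule order_trans[OF norm_sum], rule sum_mono)
       (auto simp: norm_mult intro!: mult_left_mono assms(1))
  also have "\<dots> = real L * (B * norm (coeff F M))"
    by (simp add: sum_distrib_right[symmetric] tot)
  finally show ?thesis using L by (simp add: ext)
qed

text \<open>A monomial is itself a polynomial of the shape required of \<open>F\<close> in
  \<open>pairing_bound\<close>, with \<open>M = i\<close> and \<open>\<kappa> = 1\<close>.\<close>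

lemma norm_coeff_le:
  fixes \<phi> :: "complex poly"
  assumes "\<And>z. norm z = 1 \<Longrightarrow> norm (poly \<phi> z) \<le> B"
  shows "norm (coeff \<phi> i) \<le> B"
proof -
  have "norm (\<Sum>j<Suc (i + degree \<phi>). coeff (monom 1 i) j * cnj (coeff \<phi> j))
      \<le> B * norm (coeff (monom (1::complex) i) i)"
    by (rule pairing_bound[where \<kappa> = 1])
       (use assms in \<open>auto simp: poly_monom norm_power degree_monom_eq\<close>)
  moreover have "(\<Sum>j<Suc (i + degree \<phi>). coeff (monom 1 i) j * cnj (coeff \<phi> j)) 
     = (\<Sum>j<Suc (i + degree \<phi>). if j = i then cnj (coeff \<phi> j) else 0)"
    by (rule sum.cong) auto
  moreover have "\<dots> = cnj (coeff \<phi> i)"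
    by (subst sum.delta) auto
  ultimately show ?thesis by simp
qed

subsection \<open>Test functions of Cohen and Davenport\<close>

text \<open>Greedy choice: each chosen element rules out itself and at most \<open>b\<close> others,
  so \<open>r\<close> rounds consume at most \<open>r * (b + 1)\<close> elements.\<close>

lemma independent_subset:
  fixes bad :: "'a \<Rightarrow> 'a \<Rightarrow> bool"
  assumes "finite V" "card V \<ge> r * (b + 1)"
    and "\<And>x. x \<in> V \<Longrightarrow> card {y \<in> V. bad x y} \<le> b"
    and "\<And>x y. bad x y \<Longrightarrow> bad y x"
  shows "\<exists>X\<subseteq>V. card X = r \<and> (\<forall>x\<in>X. \<forall>y\<in>X. x \<noteq> y \<longrightarrow> \<not> bad x y)"
  using assms(1-3)
proof (induction r arbitrary: V)
  case 0
  then show ?case by (intro exI[of _ "{}"]) auto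
next
  case (Suc r)
  then have "V \<noteq> {}" by auto
  then obtain x where x: "x \<in> V" by blast
  define W where "W = V - {x} - {y \<in> V. bad x y}"
  have "card V \<le> card (W \<union> ({x} \<union> {y \<in> V. bad x y}))"
    by (rule card_mono) (use Suc.prems in \<open>auto simp: W_def\<close>)
  also have "\<dots> \<le> card W + (1 + b)"
    using Suc.prems(3)[OF x] card_Un_le[of W "{x} \<union> {y \<in> V. bad x y}"]
      card_Un_le[of "{x}" "{y \<in> V. bad x y}"] by simp
  finally have "card W \<ge> r * (b + 1)" using Suc.prems(2) by simp
  moreover have "finite W" using Suc.prems(1) by (simp add: W_def)
  moreover have "card {y \<in> W. bad w y} \<le> b" if "w \<in> W" for w
  proof -
    have "card {y \<in> W. bad w y} \<le> card {y \<in> V. bad w y}"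
      by (rule card_mono) (use Suc.prems(1) in \<open>auto simp: W_def\<close>)
    then show ?thesis using Suc.prems(3)[of w] that by (auto simp: W_def)
  qed
  ultimately obtain X where X: "X \<subseteq> W" "card X = r" "\<forall>x\<in>X. \<forall>y\<in>X. x \<noteq> y \<longrightarrow> \<not> bad x y"
    using Suc.IH by meson
  have "finite X" using X \<open>finite W\<close> finite_subset by blast
  moreover have "x \<notin> X" using X by (auto simp: W_def)
  ultimately have "card (insert x X) = Suc r" using X by simp
  moreover have "insert x X \<subseteq> V" using X x by (auto simp: W_def)
  moreover have "\<forall>a\<in>insert x X. \<forall>y\<in>insert x X. a \<noteq> y \<longrightarrow> \<not> bad a y"
    using X assms(4) by (auto simp: W_def)
  ultimately show ?case by blast
qed

lemma top_split:
  fixes A :: "nat set"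
  assumes "finite A" "a \<le> card A"
  shows "\<exists>U V. A = U \<union> V \<and> U \<inter> V = {} \<and> card U = a \<and> (\<forall>u\<in>U. \<forall>v\<in>V. v < u)"
  using assms(2)
proof (induction a)
  case 0
  then show ?case by (intro exI[of _ "{}"] exI[of _ A]) auto
next
  case (Suc a)
  then obtain U V where UV: "A = U \<union> V" "U \<inter> V = {}" "card U = a" "\<forall>u\<in>U. \<forall>v\<in>V. v < u"
    by auto
  have fin: "finite U" "finite V" using UV(1) assms(1) by auto
  have "V \<noteq> {}" using UV Suc.prems by auto
  then have m: "Max V \<in> V" "\<And>v. v \<in> V \<Longrightarrow> v \<le> Max V" using fin by auto
  have "Max V \<notin> U" using UV m by auto
  have "A = insert (Max V) U \<union> (V - {Max V})" "insert (Max V) U \<inter> (V - {Max V}) = {}"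
    using UV(1,2) m(1) by blast+
  moreover have "card (insert (Max V) U) = Suc a"
    using \<open>Max V \<notin> U\<close> fin UV(3) by simp
  moreover have "\<forall>u\<in>insert (Max V) U. \<forall>v\<in>V - {Max V}. v < u"
    using UV(4) m(2) by (auto simp: order.strict_iff_order)
  ultimately show ?case by blast
qed

text \<open>In the expanded square of the sum the diagonal contributes \<open>card X\<close>, and
  the parts below and above it are conjugate. Thus the square is the real part of a one-sided sum,
  which for \<open>w x = u x * z ^ x\<close> has no negative frequencies.\<close>

lemma lower_half_sum:
  fixes w :: "nat \<Rightarrow> complex"
  assumes "finite X" "\<And>x. x \<in> X \<Longrightarrow> norm (w x) = 1"
  defines "D \<equiv> \<Sum>x\<in>X. \<Sum>y\<in>{y\<in>X. y < x}. w x * cnj (w y)"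
  shows "Re (of_nat (card X) + 2 * D) = (norm (\<Sum>x\<in>X. w x))\<^sup>2"
    and "norm (of_nat (card X) + 2 * D) \<le> 3 * (real (card X))\<^sup>2"
proof -
  have "of_real ((norm (\<Sum>x\<in>X. w x))\<^sup>2) = (\<Sum>x\<in>X. w x) * cnj (\<Sum>x\<in>X. w x)"
    by (simp only: complex_norm_square)
  also have "\<dots> = (\<Sum>x\<in>X. \<Sum>y\<in>X. w x * cnj (w y))"
    by (simp add: sum_product)
  also have "\<dots> = (\<Sum>x\<in>X. (\<Sum>y\<in>{y\<in>X. y < x}. w x * cnj (w y)) + w x * cnj (w x) + (\<Sum>y\<in>{y\<in>X. x < y}. w x * cnj (w y)))"
  proof (rule sum.cong[OF refl])
    fix x assume x: "x \<in> X"
    have "X = {y\<in>X. y < x} \<union> ({x} \<union> {y\<in>X. x < y})" using x by auto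
    then have "(\<Sum>y\<in>X. w x * cnj (w y)) = (\<Sum>y\<in>{y\<in>X. y < x} \<union> ({x} \<union> {y\<in>X. x < y}). w x * cnj (w y))"
      by simp
    also have "\<dots> = (\<Sum>y\<in>{y\<in>X. y < x}. w x * cnj (w y)) + (\<Sum>y\<in>{x} \<union> {y\<in>X. x < y}. w x * cnj (w y))"
      by (rule sum.union_disjoint) (use assms(1) in auto)
    also have "(\<Sum>y\<in>{x} \<union> {y\<in>X. x < y}. w x * cnj (w y)) = w x * cnj (w x) + (\<Sum>y\<in>{y\<in>X. x < y}. w x * cnj (w y))"
      by (subst sum.union_disjoint) (use assms(1) in auto)
    finally show "(\<Sum>y\<in>X. w x * cnj (w y)) = (\<Sum>y\<in>{y\<in>X. y < x}. w x * cnj (w y)) + w x * cnj (w x) + (\<Sum>y\<in>{y\<in>X. x < y}. w x * cnj (w y))"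
      by (simp add: add.assoc)
  qed
  also have "\<dots> = D + of_nat (card X) + (\<Sum>x\<in>X. \<Sum>y\<in>{y\<in>X. x < y}. w x * cnj (w y))"
  proof -
    have "w x * cnj (w x) = 1" if "x \<in> X" for x
      using assms(2)[OF that] by (simp add: complex_norm_square[symmetric])
    then show ?thesis by (simp add: sum.distrib D_def)
  qed
  also have "(\<Sum>x\<in>X. \<Sum>y\<in>{y\<in>X. x < y}. w x * cnj (w y)) = cnj D"
    unfolding D_def cnj_sum by (subst sum.swap_restrict) (use assms(1) in \<open>auto simp: mult.commute\<close>)
  finally have "complex_of_real ((norm (\<Sum>x\<in>X. w x))\<^sup>2) = D + of_nat (card X) + cnj D" .
  from arg_cong[OF this, of Re]
  show "Re (of_nat (card X) + 2 * D) = (norm (\<Sum>x\<in>X. w x))\<^sup>2" by simp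
  have "norm D \<le> (\<Sum>x\<in>X. real (card X))"
    unfolding D_def
  proof (rule sum_norm_le)
    fix x assume x: "x \<in> X"
    have "norm (\<Sum>y\<in>{y\<in>X. y < x}. w x * cnj (w y)) \<le> (\<Sum>y\<in>{y\<in>X. y < x}. 1)"
      by (rule sum_norm_le) (use assms(2) x in \<open>auto simp: norm_mult\<close>)
    also have "\<dots> \<le> real (card X)" using assms(1) by (auto intro!: card_mono)
    finally show "norm (\<Sum>y\<in>{y\<in>X. y < x}. w x * cnj (w y)) \<le> real (card X)" .
  qed
  then have "norm D \<le> (real (card X))\<^sup>2" by (simp add: power2_eq_square)
  moreover have "real (card X) \<le> (real (card X))\<^sup>2"
    by (cases "card X = 0") (auto simp: power2_eq_square)
  moreover have "norm (2 * D) = 2 * norm D" by (simp add: norm_mult)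
  moreover have "norm (of_nat (card X) :: complex) = real (card X)" by simp
  moreover have "norm (of_nat (card X) + 2 * D) \<le> norm (of_nat (card X) :: complex) + norm (2 * D)"
    by (rule norm_triangle_ineq)
  ultimately show "norm (of_nat (card X) + 2 * D) \<le> 3 * (real (card X))\<^sup>2"
    by linarith
qed

text \<open>Here \<open>v\<close> is the value of the old test function, \<open>w\<close> that of
  the one-sided square and \<open>e\<close> the modulus of the new sum. Multiplying by the factor
  gains \<open>e\<^sup>2 / q ^ 6\<close>, and the arithmetic-geometric mean inequality shows that
  this pays for \<open>e / q ^ 5\<close> up to an error of order \<open>1 / q ^ 4\<close>.\<close>

lemma step_bound:
  fixes v w :: complex
  assumes "q > 0" "1 \<le> B" "norm v \<le> B" "Re w = e\<^sup>2" "norm w \<le> 3 * q ^ 4" "e \<ge> 0"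
  shows "norm (v * (1 - of_real (1 / q ^ 6) * w)) + e / q ^ 5 \<le> B * (1 + 5 / q ^ 4)"
proof -
  define c where "c = 1 / q ^ 6"
  have c: "c > 0" using assms by (simp add: c_def)
  have "(norm (1 - of_real c * w))\<^sup>2 = (1 - c * Re w)\<^sup>2 + (c * Im w)\<^sup>2"
    by (simp add: cmod_power2)
  also have "\<dots> = 1 - 2 * c * e\<^sup>2 + c\<^sup>2 * (norm w)\<^sup>2"
    using cmod_power2[of w] by (simp add: assms(4) power2_eq_square algebra_simps)
  also have "\<dots> \<le> 1 - 2 * c * e\<^sup>2 + c\<^sup>2 * (3 * q ^ 4)\<^sup>2"
    using assms by (intro add_left_mono mult_left_mono power_mono) auto
  also have "c\<^sup>2 * (3 * q ^ 4)\<^sup>2 = 9 / q ^ 4"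
  proof -
    have "c\<^sup>2 * (3 * q ^ 4)\<^sup>2 = 9 * q ^ 8 / q ^ 12"
      by (simp add: c_def power_divide power_mult_distrib flip: power_mult)
    also have "q ^ 12 = q ^ 8 * q ^ 4" by (simp flip: power_add)
    finally have "c\<^sup>2 * (3 * q ^ 4)\<^sup>2 = 9 * q ^ 8 / (q ^ 8 * q ^ 4)" .
    also have "\<dots> = 9 / q ^ 4"
      using nonzero_mult_divide_mult_cancel_left[of "q ^ 8" 9 "q ^ 4"] assms(1) by (simp add: mult.commute)
    finally show ?thesis .
  qed
  finally have *: "(norm (1 - of_real c * w))\<^sup>2 \<le> 1 - 2 * c * e\<^sup>2 + 9 / q ^ 4" .
  have **: "norm (1 - of_real c * w) \<le> 1 - c * e\<^sup>2 + 9 / 2 / q ^ 4"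
  proof -
    \<comment> \<open>This linearises the bound on the square without taking a root.\<close>
    have "2 * norm (1 - of_real c * w) \<le> 1 + (norm (1 - of_real c * w))\<^sup>2"
      using zero_le_power2[of "norm (1 - of_real c * w) - 1"] by (simp add: power2_eq_square algebra_simps)
    then show ?thesis using * by (simp add: field_simps)
  qed
  have "e / q ^ 5 \<le> c * e\<^sup>2 + 1 / 2 / q ^ 4"
  proof -
    define t where "t = 1 / q"
    have "0 \<le> (e * t ^ 3 - 1 / 2 * t\<^sup>2)\<^sup>2" by simp
    also have "\<dots> = t ^ 6 * e\<^sup>2 - e * t ^ 5 + 1 / 4 * t ^ 4"
      by (simp add: power2_eq_square eval_nat_numeral algebra_simps)
    finally have "0 \<le> t ^ 6 * e\<^sup>2 - e * t ^ 5 + 1 / 4 * t ^ 4" .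
    moreover have "0 \<le> t ^ 4" using assms(1) by (simp add: t_def)
    ultimately have "e * t ^ 5 \<le> t ^ 6 * e\<^sup>2 + 1 / 2 * t ^ 4"
      by linarith
    then show ?thesis by (simp add: t_def c_def power_divide)
  qed
  \<comment> \<open>Inserting \<open>B\<close> makes the terms with \<open>e\<^sup>2\<close> in the
    two estimates cancel exactly.\<close>
  also have "\<dots> \<le> B * (c * e\<^sup>2 + 1 / 2 / q ^ 4)"
  proof -
    have "0 \<le> c * e\<^sup>2 + 1 / 2 / q ^ 4" using assms c by simp
    from mult_right_mono[OF assms(2) this] show ?thesis by simp
  qed
  finally have 3: "e / q ^ 5 \<le> B * (c * e\<^sup>2 + 1 / 2 / q ^ 4)" .
  have "norm (v * (1 - of_real c * w)) \<le> B * (1 - c * e\<^sup>2 + 9 / 2 / q ^ 4)"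
    unfolding norm_mult using ** assms by (intro mult_mono) auto
  then have "norm (v * (1 - of_real c * w)) + e / q ^ 5
     \<le> B * (1 - c * e\<^sup>2 + 9 / 2 / q ^ 4) + B * (c * e\<^sup>2 + 1 / 2 / q ^ 4)"
    using 3 by linarith
  also have "\<dots> = B * (1 + 5 / q ^ 4)"
  proof -
    have "1 - c * e\<^sup>2 + 9 / 2 / q ^ 4 + (c * e\<^sup>2 + 1 / 2 / q ^ 4) = 1 + 5 / q ^ 4"
    proof -
      define h where "h = 1 / q ^ 4"
      have "9 / 2 / q ^ 4 = 9 / 2 * h" "1 / 2 / q ^ 4 = 1 / 2 * h" "5 / q ^ 4 = 5 * h"
        by (simp_all add: h_def)
      then show ?thesis by (simp only:)
    qed
    then show ?thesis by (simp only: distrib_left[symmetric])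
  qed
  finally show ?thesis unfolding c_def .
qed

text \<open>The restriction \<open>y < x\<close> keeps all frequencies positive, so an ordinary
  polynomial suffices and truncated subtraction never interferes.\<close>

definition lower_half :: "(nat \<Rightarrow> complex) \<Rightarrow> nat set \<Rightarrow> complex poly" where
  "lower_half u X = (\<Sum>x\<in>X. \<Sum>y\<in>{y\<in>X. y < x}. monom (u x * cnj (u y)) (x - y))"

lemma poly_lower_half:
  assumes "norm z = 1"
  shows "poly (lower_half u X) z = (\<Sum>x\<in>X. \<Sum>y\<in>{y\<in>X. y < x}. (u x * z ^ x) * cnj (u y * z ^ y))"
proof -
  have "z ^ (x - y) = z ^ x * cnj (z ^ y)" if "y < x" for x y
  proof -
    have "z ^ x = z ^ (x - y) * z ^ y" using that by (simp flip: power_add)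
    moreover have "z ^ y * cnj (z ^ y) = 1"
      using assms by (simp add: complex_norm_square[symmetric] norm_power del: complex_cnj_power)
    ultimately show ?thesis by (simp add: mult.assoc del: complex_cnj_power)
  qed
  then show ?thesis
    by (auto simp: lower_half_def poly_sum poly_monom mult_ac simp del: complex_cnj_power intro!: sum.cong)
qed

lemma coeff_mult_lower_half:
  assumes "coeff (\<phi> * lower_half u X) j \<noteq> 0"
  shows "\<exists>f x y. coeff \<phi> f \<noteq> 0 \<and> x \<in> X \<and> y \<in> X \<and> y < x \<and> j + y = f + x"
proof -
  have "coeff (\<phi> * lower_half u X) j = (\<Sum>x\<in>X. \<Sum>y\<in>{y\<in>X. y < x}.
      (if j < x - y then 0 else u x * cnj (u y) * coeff \<phi> (j - (x - y))))"
    by (simp add: lower_half_def sum_distrib_left coeff_sum mult.commute[of \<phi>] coeff_monom_mult)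
  with assms have "(\<Sum>x\<in>X. \<Sum>y\<in>{y\<in>X. y < x}.
      (if j < x - y then 0 else u x * cnj (u y) * coeff \<phi> (j - (x - y)))) \<noteq> 0" by simp
  then obtain x where x: "x \<in> X" and x': "(\<Sum>y\<in>{y\<in>X. y < x}.
      (if j < x - y then 0 else u x * cnj (u y) * coeff \<phi> (j - (x - y)))) \<noteq> 0"
    by (rule sum.not_neutral_contains_not_neutral)
  from x' obtain y where "y \<in> {y\<in>X. y < x}"
      and "(if j < x - y then 0 else u x * cnj (u y) * coeff \<phi> (j - (x - y))) \<noteq> 0"
    by (rule sum.not_neutral_contains_not_neutral)
  with x show ?thesis
    by (intro exI[of _ "j - (x - y)"] exI[of _ x] exI[of _ y]) (auto split: if_splits)
qed

text \<open>
  \<open>\<phi>\<close> is the test function after \<open>s\<close> steps. A step takes \<open>q\<^sup>2\<close> new frequencies \<open>X\<close> from \<open>\<Lambda>\<close>, puts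
  \<open>E = (\<Sum>x\<in>X. u x * z ^ x)\<close> and \<open>D = lower_half u X\<close>, and replaces \<open>\<phi>\<close> by
  \<open>\<phi> * (1 - (q\<^sup>2 + 2 * D) / q ^ 6) + E / q ^ 5\<close>. Since \<open>Re (q\<^sup>2 + 2 * D) = \<bar>E\<bar>\<^sup>2\<close>, the factor makes
  room for the new term up to a relative loss of \<open>5 / q ^ 4\<close>, while each step gains \<open>1 / q ^ 3\<close>.
\<close>

definition good_test :: "nat \<Rightarrow> nat \<Rightarrow> nat \<Rightarrow> nat set \<Rightarrow> (nat \<Rightarrow> complex) \<Rightarrow> complex poly \<Rightarrow> bool" where
  "good_test q s N \<Lambda> u \<phi> \<longleftrightarrow>
     (\<forall>z. norm z = 1 \<longrightarrow> norm (poly \<phi> z) \<le> (1 + 5 / real q ^ 4) ^ s) \<and>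
     card {j. coeff \<phi> j \<noteq> 0} \<le> N \<and>
     (\<forall>j. coeff \<phi> j \<noteq> 0 \<longrightarrow> (\<exists>x\<in>\<Lambda>. x \<le> j)) \<and>
     (\<exists>y. (\<forall>x\<in>\<Lambda>. y x \<ge> 0 \<and> coeff \<phi> x = of_real (y x) * u x) \<and>
        (\<Sum>x\<in>\<Lambda>. y x) \<ge> real s / real q ^ 3 * (1 - 1 / real q ^ 4) ^ s)"

lemma finite_supp: "finite {j. coeff p j \<noteq> 0}"
  by (rule finite_subset[of _ "{..degree p}"]) (auto intro: le_degree)

text \<open>
  \<open>D\<close> only raises frequencies, so \<open>\<phi> * D\<close> can meet \<open>\<Lambda>\<close> only in the bounded top part \<open>U\<close>; this leaves
  boundedly many \<open>y\<close> to avoid for each \<open>x\<close> when \<open>X\<close> is chosen.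
\<close>

lemma good_test_step:
  assumes q: "q \<ge> 1"
    and U: "good_test q s N U u \<phi>"
    and \<Lambda>: "\<Lambda> = U \<union> V" "U \<inter> V = {}" "finite \<Lambda>" "\<forall>a\<in>U. \<forall>b\<in>V. b < a"
    and V: "card V \<ge> q\<^sup>2 * (2 * (N * card U) + 1)"
    and u: "\<And>x. x \<in> \<Lambda> \<Longrightarrow> norm (u x) = 1"
  shows "\<exists>\<psi>. good_test q (Suc s) (N + N * q ^ 4 + q\<^sup>2) \<Lambda> u \<psi>"
proof -
  define A where "A = {j. coeff \<phi> j \<noteq> 0}"
  have A: "finite A" "card A \<le> N" 
    using U by (auto simp: A_def good_test_def finite_supp)
  have fin: "finite U" "finite V" using \<Lambda> by auto
  have A_ge: "\<exists>x\<in>U. x \<le> j" if "j \<in> A" for j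
    using U that by (auto simp: A_def good_test_def)
  \<comment> \<open>A frequency \<open>f\<close> of \<open>\<phi>\<close>, shifted by
    \<open>x - y\<close>, would hit some \<open>l\<close> in \<open>U\<close>. Both orders of
    \<open>x\<close> and \<open>y\<close> are included to make the relation symmetric, as
    \<open>independent_subset\<close> demands.\<close>
  define bad where "bad x y \<longleftrightarrow> (\<exists>f\<in>A. \<exists>l\<in>U. f + x = l + y \<or> f + y = l + x)" for x y
  have "\<exists>X\<subseteq>V. card X = q\<^sup>2 \<and> (\<forall>x\<in>X. \<forall>y\<in>X. x \<noteq> y \<longrightarrow> \<not> bad x y)"
  proof (rule independent_subset[where b = "2 * (N * card U)"])
    fix x
    \<comment> \<open>For fixed \<open>x\<close>, each pair of \<open>f\<close> and \<open>l\<close>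
      excludes at most two values of \<open>y\<close>.\<close>
    have "{y \<in> V. bad x y} \<subseteq> (\<lambda>(f, l). f + x - l) ` (A \<times> U) \<union> (\<lambda>(f, l). l + x - f) ` (A \<times> U)"
    proof
      fix y assume "y \<in> {y \<in> V. bad x y}"
      then obtain f l where fl: "f \<in> A" "l \<in> U" "f + x = l + y \<or> f + y = l + x"
        by (auto simp: bad_def)
      then have "y = f + x - l \<or> y = l + x - f" by auto
      then show "y \<in> (\<lambda>(f, l). f + x - l) ` (A \<times> U) \<union> (\<lambda>(f, l). l + x - f) ` (A \<times> U)"
        using fl(1,2) by (auto intro!: rev_image_eqI[of "(f, l)"])
    qed
    then have "card {y \<in> V. bad x y} \<le> card ((\<lambda>(f, l). f + x - l) ` (A \<times> U) \<union> (\<lambda>(f, l). l + x - f) ` (A \<times> U))"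
      by (intro card_mono) (use A fin in auto)
    also have "\<dots> \<le> card ((\<lambda>(f, l). f + x - l) ` (A \<times> U)) + card ((\<lambda>(f, l). l + x - f) ` (A \<times> U))"
      by (rule card_Un_le)
    also have "\<dots> \<le> card (A \<times> U) + card (A \<times> U)"
      by (intro add_mono card_image_le) (use A fin in auto)
    also have "\<dots> \<le> 2 * (N * card U)"
    proof -
      have "card A * card U \<le> N * card U" using A(2) by (rule mult_right_mono) simp
      then show ?thesis by (simp only: card_cartesian_product mult_2 add_mono)
    qed
    finally show "card {y \<in> V. bad x y} \<le> 2 * (N * card U)" .
  next
    fix x y assume "bad x y" then show "bad y x" by (auto simp: bad_def)
  qed (use V fin in auto)
  then obtain X where X: "X \<subseteq> V" "card X = q\<^sup>2" "\<And>x y. x \<in> X \<Longrightarrow> y \<in> X \<Longrightarrow> x \<noteq> y \<Longrightarrow> \<not> bad x y"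
    by blast
  have finX: "finite X" using X fin finite_subset by blast
  define c d where "c = 1 / real q ^ 6" and "d = 1 / real q ^ 5"
  have cd: "c > 0" "d > 0" using q by (auto simp: c_def d_def)
  define D where "D = lower_half u X"
  define E where "E = (\<Sum>x\<in>X. monom (u x) x)"
  define \<psi> where "\<psi> = \<phi> * (1 - smult (of_real c) (of_nat (q\<^sup>2) + 2 * D)) + smult (of_real d) E"
  have \<psi>_eq: "\<psi> = smult (1 - of_real (c * real (q\<^sup>2))) \<phi> - smult (2 * of_real c) (\<phi> * D) + smult (of_real d) E"
    unfolding \<psi>_def by (rule poly_eqI) (simp add: algebra_simps of_nat_poly numeral_poly)
  have cE: "coeff E j = (if j \<in> X then u j else 0)" for j
    using finX by (simp add: E_def coeff_sum)
  have cD: "\<exists>f x y. f \<in> A \<and> x \<in> X \<and> y \<in> X \<and> y < x \<and> j + y = f + x" if "coeff (\<phi> * D) j \<noteq> 0" for j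
    using coeff_mult_lower_half[of \<phi> u X j] that by (simp add: D_def A_def)
  have bnd: "norm (poly \<psi> z) \<le> (1 + 5 / real q ^ 4) ^ Suc s" if z: "norm z = 1" for z
  proof -
    define w where "w = of_nat (card X) + 2 * poly D z"
    define e where "e = norm (poly E z)"
    have polyE: "poly E z = (\<Sum>x\<in>X. u x * z ^ x)" by (simp add: E_def poly_sum poly_monom)
    have n1: "norm (u x * z ^ x) = 1" if "x \<in> X" for x
      using u[of x] that X(1) \<Lambda>(1) z by (auto simp: norm_mult norm_power)
    have w1: "Re w = e\<^sup>2"
      unfolding w_def e_def polyE D_def poly_lower_half[OF z]
      by (rule lower_half_sum(1)) (use finX n1 in auto)
    have "norm w \<le> 3 * (real (card X))\<^sup>2"
      unfolding w_def e_def polyE D_def poly_lower_half[OF z]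
      by (rule lower_half_sum(2)) (use finX n1 in auto)
    then have w2: "norm w \<le> 3 * real q ^ 4" by (simp add: X(2) flip: power_mult)
    have "norm (poly \<psi> z) \<le> norm (poly \<phi> z * (1 - of_real (1 / real q ^ 6) * w)) + norm (of_real d * poly E z)"
      unfolding \<psi>_def w_def X(2) by (rule order_trans[OF _ norm_triangle_ineq]) (simp add: c_def)
    also have "norm (of_real d * poly E z) = e / real q ^ 5"
      using cd by (simp add: norm_mult norm_divide norm_power e_def d_def)
    also have "norm (poly \<phi> z * (1 - of_real (1 / real q ^ 6) * w)) + e / real q ^ 5
      \<le> (1 + 5 / real q ^ 4) ^ s * (1 + 5 / real q ^ 4)"
      by (rule step_bound) (use q U z w1 w2 in \<open>auto simp: good_test_def e_def intro!: one_le_power\<close>)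
    finally show ?thesis by (simp add: mult.commute)
  qed
  have \<psi>_supp: "coeff \<phi> j \<noteq> 0 \<or> coeff (\<phi> * D) j \<noteq> 0 \<or> j \<in> X" if "coeff \<psi> j \<noteq> 0" for j
    by (rule ccontr) (use that in \<open>simp add: \<psi>_eq cE\<close>)
  have "{j. coeff \<psi> j \<noteq> 0} \<subseteq> A \<union> (\<lambda>(f, x, y). f + x - y) ` (A \<times> X \<times> X) \<union> X"
  proof
    fix j assume "j \<in> {j. coeff \<psi> j \<noteq> 0}"
    then have "coeff \<psi> j \<noteq> 0" by simp
    then consider "coeff \<phi> j \<noteq> 0" | "coeff (\<phi> * D) j \<noteq> 0" | "j \<in> X"
      using \<psi>_supp by blast
    then show "j \<in> A \<union> (\<lambda>(f, x, y). f + x - y) ` (A \<times> X \<times> X) \<union> X"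
    proof cases
      case 2
      from cD[OF this] obtain f x y where "f \<in> A" "x \<in> X" "y \<in> X" "j + y = f + x" by blast
      then show ?thesis by (auto intro!: rev_image_eqI[of "(f, x, y)"])
    qed (auto simp: A_def)
  qed
  then have "card {j. coeff \<psi> j \<noteq> 0} \<le> card (A \<union> (\<lambda>(f, x, y). f + x - y) ` (A \<times> X \<times> X) \<union> X)"
    by (rule card_mono[rotated]) (use A finX in auto)
  also have "\<dots> \<le> card A + card ((\<lambda>(f, x, y). f + x - y) ` (A \<times> X \<times> X)) + card X"
    by (intro order_trans[OF card_Un_le] add_mono order_refl card_Un_le)
  also have "\<dots> \<le> card A + card (A \<times> X \<times> X) + card X"
    by (intro add_mono order_refl card_image_le) (use A finX in auto)
  also have "\<dots> \<le> N + N * q ^ 4 + q\<^sup>2"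
    using A(2) X(2) by (auto simp: card_cartesian_product power2_eq_square eval_nat_numeral intro!: add_mono mult_right_mono)
  finally have supp: "card {j. coeff \<psi> j \<noteq> 0} \<le> N + N * q ^ 4 + q\<^sup>2" .
  have low: "\<exists>x\<in>\<Lambda>. x \<le> j" if "coeff \<psi> j \<noteq> 0" for j
  proof -
    from that consider "coeff \<phi> j \<noteq> 0" | "coeff (\<phi> * D) j \<noteq> 0" | "j \<in> X"
      using \<psi>_supp by blast
    then show ?thesis
    proof cases
      case 1 then show ?thesis using A_ge[of j] \<Lambda>(1) by (auto simp: A_def)
    next
      case 2
      from cD[OF this] obtain f x y where fxy: "f \<in> A" "x \<in> X" "y \<in> X" "y < x" "j + y = f + x" by blast
      then obtain l where "l \<in> U" "l \<le> f" using A_ge by blast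
      then show ?thesis using fxy \<Lambda>(1) by (intro bexI[of _ l]) auto
    next
      case 3 then show ?thesis using X(1) \<Lambda>(1) by auto
    qed
  qed
  \<comment> \<open>Such an \<open>l\<close> would lie strictly above some element of
    \<open>U\<close>, hence in \<open>U\<close> itself because \<open>V\<close> lies below
    \<open>U\<close>; then the two elements of \<open>X\<close> producing it would be bad.\<close>
  have D0: "coeff (\<phi> * D) l = 0" if l: "l \<in> \<Lambda>" for l
  proof (rule ccontr)
    assume "coeff (\<phi> * D) l \<noteq> 0"
    from cD[OF this] obtain f x y where fxy: "f \<in> A" "x \<in> X" "y \<in> X" "y < x" "l + y = f + x" by blast
    obtain l' where l': "l' \<in> U" "l' \<le> f" using A_ge[OF fxy(1)] by blast
    then have "l' < l" using fxy by linarith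
    then have "l \<in> U" using l \<Lambda>(1,4) l'(1) by (meson Un_iff order.asym)
    then have "bad x y" unfolding bad_def by (intro bexI[OF _ fxy(1)] bexI[of _ l] disjI1) (simp_all add: fxy(5))
    then show False using X(3) fxy by auto
  qed
  have \<phi>V: "coeff \<phi> l = 0" if "l \<in> V" for l
    using A_ge[of l] \<Lambda>(4) that by (auto simp: A_def not_le[symmetric])
  from U obtain y where y: "\<And>x. x \<in> U \<Longrightarrow> y x \<ge> 0 \<and> coeff \<phi> x = of_real (y x) * u x"
      "(\<Sum>x\<in>U. y x) \<ge> real s / real q ^ 3 * (1 - 1 / real q ^ 4) ^ s"
    unfolding good_test_def by blast
  define t where "t = 1 - 1 / real q ^ 4"
  have t: "t \<ge> 0" "t \<le> 1" using q by (auto simp: t_def)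
  have ct: "1 - c * real (q\<^sup>2) = t"
  proof -
    have eq: "real q ^ 6 = real q ^ 4 * (real q)\<^sup>2" by (simp flip: power_add)
    have "(real q)\<^sup>2 / (real q ^ 4 * (real q)\<^sup>2) = 1 / real q ^ 4"
      by (rule nonzero_divide_mult_cancel_right) (use q in simp)
    then show ?thesis unfolding c_def t_def eq by (simp only: of_nat_power times_divide_eq_left mult_1)
  qed
  \<comment> \<open>Old weights are damped by \<open>t\<close>, the effect of the diagonal term
    \<open>q\<^sup>2\<close> in the factor; each of the new frequencies, none of which lies in
    \<open>U\<close>, gets weight \<open>d\<close>.\<close>
  define y' where "y' x = t * (if x \<in> U then y x else 0) + (if x \<in> X then d else 0)" for x
  have "y' x \<ge> 0 \<and> coeff \<psi> x = of_real (y' x) * u x" if x: "x \<in> \<Lambda>" for x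
  proof (cases "x \<in> U")
    case True
    then have "x \<notin> X" using X(1) \<Lambda>(2) by auto
    then show ?thesis using True y(1)[OF True] D0[OF x] t
      unfolding \<psi>_eq ct by (simp add: y'_def cE flip: of_real_diff) (simp flip: ct)
  next
    case False
    then have "x \<in> V" using x \<Lambda>(1) by auto
    then show ?thesis using False D0[OF x] \<phi>V[of x] cd
      unfolding \<psi>_eq by (simp add: y'_def cE)
  qed
  moreover have "(\<Sum>x\<in>\<Lambda>. y' x) \<ge> real (Suc s) / real q ^ 3 * (1 - 1 / real q ^ 4) ^ Suc s"
  proof -
    have "(\<Sum>x\<in>\<Lambda>. y' x) = t * (\<Sum>x\<in>\<Lambda>. if x \<in> U then y x else 0) + (\<Sum>x\<in>\<Lambda>. if x \<in> X then d else 0)"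
      by (simp add: y'_def sum.distrib sum_distrib_left)
    also have "(\<Sum>x\<in>\<Lambda>. if x \<in> U then y x else 0) = (\<Sum>x\<in>U. y x)"
      by (subst sum.inter_restrict[symmetric]) (use \<Lambda> in \<open>auto intro!: sum.cong\<close>)
    also have "(\<Sum>x\<in>\<Lambda>. if x \<in> X then d else 0) = (\<Sum>x\<in>X. d)"
    proof -
      have "\<Lambda> \<inter> X = X" using X(1) \<Lambda>(1) by blast
      then show ?thesis using \<Lambda>(3) by (simp flip: sum.inter_restrict)
    qed
    \<comment> \<open>This is the gain of one step: \<open>q\<^sup>2\<close> frequencies of weight
      \<open>1 / q ^ 5\<close>.\<close>
    also have "(\<Sum>x\<in>X. d) = 1 / real q ^ 3"
    proof -
      have eq: "real q ^ 5 = real q ^ 3 * (real q)\<^sup>2" by (simp flip: power_add)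
      have "(real q)\<^sup>2 / (real q ^ 3 * (real q)\<^sup>2) = 1 / real q ^ 3"
        by (rule nonzero_divide_mult_cancel_right) (use q in simp)
      then show ?thesis unfolding d_def eq sum_constant X(2)
        by (simp only: of_nat_power times_divide_eq_right mult_1_right)
    qed
    finally have "(\<Sum>x\<in>\<Lambda>. y' x) = t * (\<Sum>x\<in>U. y x) + 1 / real q ^ 3" .
    moreover have "t * (\<Sum>x\<in>U. y x) \<ge> t * (real s / real q ^ 3 * t ^ s)"
      using y(2) t by (intro mult_left_mono) (auto simp: t_def)
    moreover have "1 / real q ^ 3 \<ge> 1 / real q ^ 3 * t ^ Suc s"
      using t q by (intro mult_left_le power_le_one) auto
    ultimately have "(\<Sum>x\<in>\<Lambda>. y' x) \<ge> t * (real s / real q ^ 3 * t ^ s) + 1 / real q ^ 3 * t ^ Suc s"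
      by linarith
    also have "t * (real s / real q ^ 3 * t ^ s) + 1 / real q ^ 3 * t ^ Suc s = real (Suc s) / real q ^ 3 * t ^ Suc s"
      by (simp add: add_divide_distrib algebra_simps)
    finally show ?thesis by (simp add: t_def)
  qed
  ultimately have "good_test q (Suc s) (N + N * q ^ 4 + q\<^sup>2) \<Lambda> u \<psi>"
    unfolding good_test_def using bnd supp low by blast
  then show ?thesis by blast
qed

text \<open>Each step reserves the \<open>K\<close> highest frequencies for the previous test
  function and selects from the rest, which must number at least
  \<open>q\<^sup>2 * (2 * (N * K) + 1)\<close>. What matters is that \<open>N\<close>, the bound on
  the number of frequencies, does not depend on \<open>\<Lambda>\<close> or
  \<open>u\<close>.\<close>

lemma good_test_exists:
  assumes "q \<ge> 1"
  shows "\<exists>K N. \<forall>\<Lambda> u. finite \<Lambda> \<longrightarrow> K \<le> card \<Lambda> \<longrightarrow> (\<forall>x\<in>\<Lambda>. norm (u x) = 1) \<longrightarrow> (\<exists>\<phi>. good_test q s N \<Lambda> u \<phi>)"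
proof (induction s)
  case 0
  show ?case by (intro exI[of _ 0] allI impI exI[of _ "0 :: complex poly"]) (auto simp: good_test_def intro!: exI[of _ "\<lambda>_. 0"])
next
  case (Suc s)
  then obtain K N where KN: "\<And>\<Lambda> u. finite \<Lambda> \<Longrightarrow> K \<le> card \<Lambda> \<Longrightarrow> (\<forall>x\<in>\<Lambda>. norm (u x) = 1) \<Longrightarrow> (\<exists>\<phi>. good_test q s N \<Lambda> u \<phi>)"
    by blast
  show ?case
  proof (rule exI[of _ "K + q\<^sup>2 * (2 * (N * K) + 1)"], rule exI[of _ "N + N * q ^ 4 + q\<^sup>2"], intro allI impI)
    fix \<Lambda> :: "nat set" and u :: "nat \<Rightarrow> complex"
    assume *: "finite \<Lambda>" "K + q\<^sup>2 * (2 * (N * K) + 1) \<le> card \<Lambda>" "\<forall>x\<in>\<Lambda>. norm (u x) = 1"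
    obtain U V where UV: "\<Lambda> = U \<union> V" "U \<inter> V = {}" "card U = K" "\<forall>a\<in>U. \<forall>b\<in>V. b < a"
      using top_split[of \<Lambda> K] * by auto
    have fin: "finite U" "finite V" using UV * by auto
    obtain \<phi> where \<phi>: "good_test q s N U u \<phi>" using KN[of U u] UV * fin by auto
    have "card \<Lambda> = card U + card V" using UV fin by (simp add: card_Un_disjoint)
    then show "\<exists>\<phi>. good_test q (Suc s) (N + N * q ^ 4 + q\<^sup>2) \<Lambda> u \<phi>"
      using * UV by (intro good_test_step[OF assms \<phi> UV(1,2) _ UV(4)]) auto
  qed
qed

section \<open>Bounding the number of large coefficients\<close>

lemma exp_le_one_minus_inverse_power:
  assumes "m \<ge> 2"
  shows "exp (- 2) \<le> (1 - 1 / real m) ^ m"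
proof -
  have "exp (- (2 / real m)) \<le> 1 - 1 / real m"
  proof -
    have "1 \<le> (1 - 1 / real m) * (1 + 2 / real m)"
      using assms by (simp add: field_simps)
    also have "\<dots> \<le> (1 - 1 / real m) * exp (2 / real m)"
      using assms by (intro mult_left_mono exp_ge_add_one_self) auto
    finally show ?thesis by (simp add: exp_minus field_simps)
  qed
  then have "exp (- (2 / real m)) ^ m \<le> (1 - 1 / real m) ^ m"
    by (intro power_mono) auto
  also have "exp (- (2 / real m)) ^ m = exp (- 2)"
    using assms by (simp flip: exp_of_nat_mult)
  finally show ?thesis .
qed

text \<open>After \<open>q ^ 4\<close> steps the test function is bounded by \<open>exp 5\<close>,
  while its weights on \<open>\<Lambda>\<close> sum to at least \<open>q * exp (- 2)\<close>. By
  \<open>pairing_bound\<close> the pairing with \<open>F\<close> is at most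
  \<open>exp 5 * \<bar>C\<bar>\<close>, which is impossible for large \<open>q\<close> if
  \<open>\<Lambda>\<close> is large enough to carry a test function.\<close>

lemma few_large_coeffs:
  assumes "\<delta> > 0"
  shows "\<exists>K \<eta>. \<eta> > 0 \<and> (\<forall>(F :: complex poly) \<kappa> M \<Lambda>. norm \<kappa> = 1 \<longrightarrow>
     (\<forall>z. norm z = 1 \<longrightarrow> poly F z = \<kappa> * z ^ M * of_real (norm (poly F z))) \<longrightarrow>
     norm (coeff F M) \<le> C \<longrightarrow> (\<forall>x\<in>\<Lambda>. \<delta> \<le> norm (coeff F x)) \<longrightarrow>
     (\<forall>x. x \<notin> \<Lambda> \<longrightarrow> norm (coeff F x) \<le> \<eta>) \<longrightarrow> card \<Lambda> < K)"
proof -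
  \<comment> \<open>The choice makes the main term \<open>\<delta> * q * exp (- 2)\<close> exceed
    the upper bound of the pairing by more than the error 1 from outside
    \<open>\<Lambda>\<close>.\<close>
  obtain q where q: "real q > max 2 ((exp 5 * \<bar>C\<bar> + 1) / (\<delta> * exp (- 2)))"
    using reals_Archimedean2 by blast
  then have q2: "q \<ge> 2" and qC: "\<delta> * (real q * exp (- 2)) > exp 5 * \<bar>C\<bar> + 1"
    using assms by (auto simp: field_simps)
  have q4: "q ^ 4 \<ge> 2" using q2 self_le_power[of q 4] by linarith
  obtain K N where KN: "\<And>\<Lambda> u. finite \<Lambda> \<Longrightarrow> K \<le> card \<Lambda> \<Longrightarrow> (\<forall>x\<in>\<Lambda>. norm (u x) = 1) \<Longrightarrow> (\<exists>\<phi>. good_test q (q ^ 4) N \<Lambda> u \<phi>)"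
    using good_test_exists[of q "q ^ 4"] q2 by (metis Suc_1 Suc_leD One_nat_def)
  \<comment> \<open>At most \<open>N\<close> coefficients of \<open>\<phi>\<close> are nonzero, each
    of modulus at most \<open>exp 5\<close>, so coefficients of \<open>F\<close> of size
    \<open>\<eta>\<close> contribute less than 1 in total.\<close>
  define \<eta> :: real where "\<eta> = 1 / (exp 5 * (real N + 1))"
  have \<eta>: "\<eta> > 0" by (simp add: \<eta>_def)
  have "card \<Lambda> < Suc K"
    if \<kappa>: "norm \<kappa> = 1" and F: "\<forall>z. norm z = 1 \<longrightarrow> poly F z = \<kappa> * z ^ M * of_real (norm (poly F z))"
      and FC: "norm (coeff F M) \<le> C" and big: "\<forall>x\<in>\<Lambda>. \<delta> \<le> norm (coeff F x)"
      and small: "\<forall>x. x \<notin> \<Lambda> \<longrightarrow> norm (coeff F x) \<le> \<eta>" for F :: "complex poly" and \<kappa> M \<Lambda>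
  proof (rule ccontr)
    assume "\<not> card \<Lambda> < Suc K"
    have \<Lambda>deg: "\<Lambda> \<subseteq> {..degree F}"
      using big assms by (force intro: le_degree)
    then have fin: "finite \<Lambda>" using finite_subset by blast
    \<comment> \<open>With these phases every term of the pairing over \<open>\<Lambda>\<close> is a
      nonnegative real.\<close>
    define u where "u x = sgn (coeff F x)" for x
    have u: "norm (u x) = 1" if "x \<in> \<Lambda>" for x
      using big assms that by (auto simp: u_def norm_sgn)
    obtain \<phi> where \<phi>: "good_test q (q ^ 4) N \<Lambda> u \<phi>"
      using KN[of \<Lambda> u] fin u \<open>\<not> card \<Lambda> < Suc K\<close> by auto
    have \<phi>b: "norm (poly \<phi> z) \<le> exp 5" if "norm z = 1" for z
    proof -
      have "norm (poly \<phi> z) \<le> (1 + 5 / real q ^ 4) ^ (q ^ 4)"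
        using \<phi> that by (simp add: good_test_def)
      also have "\<dots> \<le> exp 5"
        using exp_ge_one_plus_x_over_n_power_n[of "q ^ 4" 5] q2
        by (simp add: order_trans[of _ 0])
      finally show ?thesis .
    qed
    define L where "L = Suc (degree F + degree \<phi>)"
    have "\<bar>Re (\<Sum>i<L. coeff F i * cnj (coeff \<phi> i))\<bar> \<le> norm (\<Sum>i<L. coeff F i * cnj (coeff \<phi> i))"
      by (rule abs_Re_le_cmod)
    also have "\<dots> \<le> exp 5 * norm (coeff F M)"
      by (rule pairing_bound[OF \<phi>b _ \<kappa>]) (use F in \<open>auto simp: L_def\<close>)
    also have "\<dots> \<le> exp 5 * \<bar>C\<bar>"
      using FC by (intro mult_left_mono) auto
    finally have up: "Re (\<Sum>i<L. coeff F i * cnj (coeff \<phi> i)) \<le> exp 5 * \<bar>C\<bar>" by linarith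
    have "{..<L} = \<Lambda> \<union> ({..<L} - \<Lambda>)" using \<Lambda>deg by (auto simp: L_def)
    then have "(\<Sum>i<L. coeff F i * cnj (coeff \<phi> i)) = (\<Sum>i\<in>\<Lambda> \<union> ({..<L} - \<Lambda>). coeff F i * cnj (coeff \<phi> i))"
      by simp
    also have "\<dots> = (\<Sum>i\<in>\<Lambda>. coeff F i * cnj (coeff \<phi> i)) + (\<Sum>i\<in>{..<L} - \<Lambda>. coeff F i * cnj (coeff \<phi> i))"
      by (rule sum.union_disjoint) (use fin in auto)
    finally have split: "Re (\<Sum>i<L. coeff F i * cnj (coeff \<phi> i))
      = Re (\<Sum>i\<in>\<Lambda>. coeff F i * cnj (coeff \<phi> i)) + Re (\<Sum>i\<in>{..<L} - \<Lambda>. coeff F i * cnj (coeff \<phi> i))" by simp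
    have "norm (\<Sum>i\<in>{..<L} - \<Lambda>. coeff F i * cnj (coeff \<phi> i)) \<le> (\<Sum>i\<in>{..<L} - \<Lambda>. if coeff \<phi> i \<noteq> 0 then \<eta> * exp 5 else 0)"
      using small \<eta> norm_coeff_le[OF \<phi>b] by (intro sum_norm_le) (auto simp: norm_mult intro!: mult_mono)
    also have "\<dots> = (\<Sum>i\<in>({..<L} - \<Lambda>) \<inter> {i. coeff \<phi> i \<noteq> 0}. \<eta> * exp 5)"
      by (subst sum.inter_restrict) auto
    also have "\<dots> = real (card (({..<L} - \<Lambda>) \<inter> {i. coeff \<phi> i \<noteq> 0})) * (\<eta> * exp 5)" by simp
    also have "\<dots> \<le> real N * (\<eta> * exp 5)"
    proof -
      have "card (({..<L} - \<Lambda>) \<inter> {i. coeff \<phi> i \<noteq> 0}) \<le> card {i. coeff \<phi> i \<noteq> 0}"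
        by (intro card_mono finite_supp) auto
      also have "\<dots> \<le> N" using \<phi> by (simp add: good_test_def)
      finally show ?thesis using \<eta> by (intro mult_right_mono) auto
    qed
    also have "\<eta> * exp 5 = 1 / (real N + 1)" by (simp add: \<eta>_def)
    also have "real N * (1 / (real N + 1)) \<le> 1" by (simp add: field_simps)
    finally have "\<bar>Re (\<Sum>i\<in>{..<L} - \<Lambda>. coeff F i * cnj (coeff \<phi> i))\<bar> \<le> 1"
      using abs_Re_le_cmod order_trans by blast
    moreover have "Re (\<Sum>i\<in>\<Lambda>. coeff F i * cnj (coeff \<phi> i)) \<ge> \<delta> * (real q * exp (- 2))"
    proof -
      obtain y where y: "\<And>x. x \<in> \<Lambda> \<Longrightarrow> y x \<ge> 0 \<and> coeff \<phi> x = of_real (y x) * u x"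
        "(\<Sum>x\<in>\<Lambda>. y x) \<ge> real (q ^ 4) / real q ^ 3 * (1 - 1 / real q ^ 4) ^ (q ^ 4)"
        using \<phi> unfolding good_test_def by blast
      have "coeff F x * cnj (coeff \<phi> x) = of_real (norm (coeff F x) * y x)" if "x \<in> \<Lambda>" for x
      proof -
        have "coeff F x = of_real (norm (coeff F x)) * u x"
          by (simp add: u_def sgn_eq)
        then have "coeff F x * cnj (coeff \<phi> x) = of_real (norm (coeff F x)) * of_real (y x) * (u x * cnj (u x))"
          using y(1)[OF that] by (metis complex_cnj_complex_of_real complex_cnj_mult mult.assoc mult.left_commute)
        then show ?thesis using u[OF that] by (simp add: complex_norm_square[symmetric])
      qed
      then have "Re (\<Sum>i\<in>\<Lambda>. coeff F i * cnj (coeff \<phi> i)) = (\<Sum>i\<in>\<Lambda>. norm (coeff F i) * y i)"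
        by (simp add: Re_sum)
      also have "\<dots> \<ge> (\<Sum>i\<in>\<Lambda>. \<delta> * y i)"
        using big y by (intro sum_mono mult_right_mono) auto
      also have "(\<Sum>i\<in>\<Lambda>. \<delta> * y i) = \<delta> * (\<Sum>i\<in>\<Lambda>. y i)" by (simp add: sum_distrib_left)
      also have "\<dots> \<ge> \<delta> * (real q * exp (- 2))"
      proof (rule mult_left_mono)
        have "real (q ^ 4) / real q ^ 3 = real q" using q2 by (simp add: eval_nat_numeral)
        moreover have "exp (- 2) \<le> (1 - 1 / real q ^ 4) ^ (q ^ 4)"
          using exp_le_one_minus_inverse_power[OF q4] by simp
        ultimately have "real q * exp (- 2) \<le> real (q ^ 4) / real q ^ 3 * (1 - 1 / real q ^ 4) ^ (q ^ 4)"
          by (simp only:) (intro mult_left_mono; simp)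
        then show "real q * exp (- 2) \<le> (\<Sum>i\<in>\<Lambda>. y i)" using y(2) by linarith
      qed (use assms in simp)
      finally show ?thesis .
    qed
    ultimately show False using up split qC by linarith
  qed
  then show ?thesis using \<eta> by (intro exI[of _ "Suc K"] exI[of _ \<eta>]) blast
qed

subsection \<open>Removing the unimodular zeros\<close>

text \<open>The real factor of a self-reciprocal polynomial at \<open>cis (2 * \<theta>)\<close>.
  Using the half angle keeps the frequencies \<open>n - 2 * j\<close> integral for odd
  \<open>n\<close>.\<close>

definition cos_sum :: "nat \<Rightarrow> (nat \<Rightarrow> real) \<Rightarrow> real \<Rightarrow> real" where
  "cos_sum n c \<theta> = (\<Sum>j\<le>n. c j * cos ((real n - 2 * real j) * \<theta>))"

lemma poly_coeff_poly: "poly (coeff_poly n c) z = (\<Sum>j\<le>n. of_real (c j) * z ^ j)"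
  by (simp add: coeff_poly_def poly_sum poly_monom)

lemma coeff_coeff_poly: "coeff (coeff_poly n c) j = (if j \<le> n then of_real (c j) else 0)"
  by (simp add: coeff_poly_def coeff_sum)

text \<open>After the phase \<open>cis (n * \<theta>)\<close> is extracted, the reflection of
  \<open>j\<close> to \<open>n - j\<close> changes the sign of every sine and fixes the
  coefficients, so the imaginary part vanishes.\<close>

lemma poly_coeff_poly_cis:
  assumes "self_reciprocal n c"
  shows "poly (coeff_poly n c) (cis (2 * \<theta>)) = cis (real n * \<theta>) * of_real (cos_sum n c \<theta>)"
proof -
  have 1: "cis (2 * \<theta>) ^ j = cis (real n * \<theta>) * cis ((2 * real j - real n) * \<theta>)" for j
    unfolding Complex.DeMoivre cis_mult by (rule arg_cong[where f = cis]) (simp add: algebra_simps)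
  have "poly (coeff_poly n c) (cis (2 * \<theta>)) = cis (real n * \<theta>) * (\<Sum>j\<le>n. of_real (c j) * cis ((2 * real j - real n) * \<theta>))"
    unfolding poly_coeff_poly 1 by (simp add: sum_distrib_left mult_ac)
  moreover have "(\<Sum>j\<le>n. of_real (c j) * cis ((2 * real j - real n) * \<theta>)) = of_real (cos_sum n c \<theta>)"
  proof (rule complex_eqI)
    have "cos ((2 * real j - real n) * \<theta>) = cos ((real n - 2 * real j) * \<theta>)" for j
      using cos_minus[of "(real n - 2 * real j) * \<theta>"] by (simp add: algebra_simps)
    then show "Re (\<Sum>j\<le>n. of_real (c j) * cis ((2 * real j - real n) * \<theta>)) = Re (of_real (cos_sum n c \<theta>))"
      by (simp add: cos_sum_def Re_sum)
    have "(\<Sum>j\<le>n. c j * sin ((2 * real j - real n) * \<theta>)) = (\<Sum>j\<le>n. c (n - j) * sin ((2 * real (n - j) - real n) * \<theta>))"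
      by (rule sum.reindex_bij_witness[where i = "\<lambda>j. n - j" and j = "\<lambda>j. n - j"]) auto
    also have "\<dots> = (\<Sum>j\<le>n. - (c j * sin ((2 * real j - real n) * \<theta>)))"
    proof (rule sum.cong[OF refl])
      fix j assume "j \<in> {..n}"
      then have "c (n - j) = c j" and n: "real (n - j) = real n - real j"
        using assms by (metis self_reciprocal_def atMost_iff, simp)
      moreover have "(2 * real (n - j) - real n) * \<theta> = - ((2 * real j - real n) * \<theta>)"
        unfolding n by (simp add: algebra_simps)
      ultimately show "c (n - j) * sin ((2 * real (n - j) - real n) * \<theta>) = - (c j * sin ((2 * real j - real n) * \<theta>))"
        by (simp only: sin_minus mult_minus_right)
    qed
    finally have "(\<Sum>j\<le>n. c j * sin ((2 * real j - real n) * \<theta>)) = 0"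
      by (simp add: sum_negf)
    then show "Im (\<Sum>j\<le>n. of_real (c j) * cis ((2 * real j - real n) * \<theta>)) = Im (of_real (cos_sum n c \<theta>))"
      by (simp add: Im_sum)
  qed
  ultimately show ?thesis by simp
qed

lemma cis_diff: "cis (2 * \<theta>) - cis (2 * \<beta>) = \<i> * cis \<beta> * cis \<theta> * of_real (2 * sin (\<theta> - \<beta>))"
proof -
  have sin_cis: "\<i> * of_real (2 * sin x) = cis x - cis (- x)" for x
    by (simp add: complex_eq_iff)
  have "\<i> * cis \<beta> * cis \<theta> * of_real (2 * sin (\<theta> - \<beta>)) = cis (\<beta> + \<theta>) * (\<i> * of_real (2 * sin (\<theta> - \<beta>)))"
    by (simp only: cis_mult[symmetric] mult_ac)
  also have "\<dots> = cis (\<beta> + \<theta>) * (cis (\<theta> - \<beta>) - cis (- (\<theta> - \<beta>)))"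
    by (simp only: sin_cis)
  also have "\<dots> = cis (2 * \<theta>) - cis (2 * \<beta>)"
    by (simp add: right_diff_distrib cis_mult algebra_simps)
  finally show ?thesis by simp
qed

lemma unimodular_cis: "norm z = 1 \<Longrightarrow> z = cis (2 * (Arg z / 2))"
  using cis_Arg[of z] by (cases "z = 0") (auto simp: sgn_eq)

text \<open>The map is injective on short intervals. The consequence used later is that a nonzero
  polynomial cannot vanish on an arc.\<close>

lemma infinite_cis_ball:
  assumes "e > 0"
  shows "infinite ((\<lambda>t. cis (2 * t)) ` ball \<theta> e)"
proof
  assume "finite ((\<lambda>t. cis (2 * t)) ` ball \<theta> e)"
  then have fin: "finite ((\<lambda>t. cis (2 * t)) ` ball \<theta> (min e 1))"
    by (rule finite_subset[rotated]) auto
  have "inj_on (\<lambda>t. cis (2 * t)) (ball \<theta> (min e 1))"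
  proof (rule inj_onI)
    fix s t assume st: "s \<in> ball \<theta> (min e 1)" "t \<in> ball \<theta> (min e 1)" "cis (2 * s) = cis (2 * t)"
    then have "\<bar>s - t\<bar> < 2" by (auto simp: dist_real_def)
    moreover have "sin (s - t) = 0"
      using cis_diff[of s t] st(3) by simp
    ultimately show "s = t"
      using sin_eq_0_pi[of "s - t"] pi_gt3 by auto
  qed
  with fin have "finite (ball \<theta> (min e 1))" using finite_imageD by blast
  then show False
    using assms infinite_Ioo[of "\<theta> - min e 1" "\<theta> + min e 1"] by (simp add: ball_eq_greaterThanLessThan)
qed

text \<open>By \<open>cis_diff\<close> each linear factor is a constant times
  \<open>cis \<theta>\<close> times a real sine, and the phases multiply up.\<close>

lemma unimodular_roots_cis:
  fixes p :: "complex poly"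
  assumes "\<And>z. z \<in> set zs \<Longrightarrow> norm z = 1"
  shows "\<exists>\<kappa> V. norm \<kappa> = 1 \<and> (\<forall>\<theta>. poly (\<Prod>z\<leftarrow>zs. [:- z, 1:]) (cis (2 * \<theta>))
     = \<kappa> * cis (real (length zs) * \<theta>) * of_real (V \<theta>))"
  using assms
proof (induction zs)
  case Nil
  then show ?case by (intro exI[of _ 1] exI[of _ "\<lambda>_. 1"]) auto
next
  case (Cons z zs)
  then obtain \<kappa> V where *: "norm \<kappa> = 1" "\<And>\<theta>. poly (\<Prod>z\<leftarrow>zs. [:- z, 1:]) (cis (2 * \<theta>)) = \<kappa> * cis (real (length zs) * \<theta>) * of_real (V \<theta>)"
    by auto
  define \<beta> where "\<beta> = Arg z / 2"
  have "norm z = 1" using Cons.prems[of z] by simp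
  then have z: "z = cis (2 * \<beta>)"
    unfolding \<beta>_def by (rule unimodular_cis)
  show ?case
  proof (rule exI[of _ "\<i> * cis \<beta> * \<kappa>"], rule exI[of _ "\<lambda>\<theta>. 2 * sin (\<theta> - \<beta>) * V \<theta>"], intro conjI allI)
    fix \<theta>
    have "poly (\<Prod>z\<leftarrow>z # zs. [:- z, 1:]) (cis (2 * \<theta>)) = (cis (2 * \<theta>) - cis (2 * \<beta>)) * (\<kappa> * cis (real (length zs) * \<theta>) * of_real (V \<theta>))"
      using *(2)[of \<theta>] z by (simp add: left_diff_distrib)
    also have "\<dots> = \<i> * cis \<beta> * \<kappa> * (cis \<theta> * cis (real (length zs) * \<theta>)) * of_real (2 * sin (\<theta> - \<beta>) * V \<theta>)"
      unfolding cis_diff by (simp only: of_real_mult mult_ac)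
    also have "cis \<theta> * cis (real (length zs) * \<theta>) = cis (real (length (z # zs)) * \<theta>)"
      by (simp add: cis_mult algebra_simps)
    finally show "poly (\<Prod>z\<leftarrow>z # zs. [:- z, 1:]) (cis (2 * \<theta>)) = \<i> * cis \<beta> * \<kappa> * cis (real (length (z # zs)) * \<theta>) * of_real (2 * sin (\<theta> - \<beta>) * V \<theta>)" .
  qed (use *(1) in \<open>simp add: norm_mult\<close>)
qed

section \<open>Splitting off the unimodular zeros\<close>

lemma monic_prod_linear: "lead_coeff (\<Prod>z\<leftarrow>zs. [:- z, 1:] :: complex poly) = 1"
   "degree (\<Prod>z\<leftarrow>zs. [:- z, 1:] :: complex poly) = length zs"
proof (induction zs)
  case (Cons z zs)
  have "(\<Prod>z\<leftarrow>zs. [:- z, 1:] :: complex poly) \<noteq> 0" using Cons by auto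
  { case 1 show ?case using Cons by (simp only: list.map prod_list.Cons lead_coeff_mult) simp }
  { case 2 show ?case using Cons \<open>(\<Prod>z\<leftarrow>zs. [:- z, 1:] :: complex poly) \<noteq> 0\<close>
      by (simp only: list.map prod_list.Cons) (subst degree_mult_eq; simp) }
qed auto

text \<open>One unimodular zero is removed at a time; by additivity of the order this lowers the sum
  of the orders by exactly one.\<close>

lemma unimodular_factor:
  fixes P :: "complex poly"
  assumes "P \<noteq> 0"
  shows "\<exists>zs P1. P = (\<Prod>z\<leftarrow>zs. [:- z, 1:]) * P1 \<and> (\<forall>z\<in>set zs. norm z = 1) \<and> (\<forall>z. norm z = 1 \<longrightarrow> poly P1 z \<noteq> 0)
     \<and> length zs = (\<Sum>z | norm z = 1 \<and> poly P z = 0. order z P)"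
  using assms
proof (induction "degree P" arbitrary: P rule: less_induct)
  case less
  show ?case
  proof (cases "\<exists>w. norm w = 1 \<and> poly P w = 0")
    case False
    then have "{z. norm z = 1 \<and> poly P z = 0} = {}" by blast
    then have "(\<Sum>z | norm z = 1 \<and> poly P z = 0. order z P) = 0" by (simp only: sum.empty)
    then show ?thesis using False by (intro exI[of _ "[]"] exI[of _ P]) auto
  next
    case True
    then obtain w where w: "norm w = 1" "poly P w = 0" by blast
    then obtain P' where P': "P = [:- w, 1:] * P'" by (auto simp: poly_eq_0_iff_dvd dvd_def)
    have "P' \<noteq> 0" using P' less.prems by auto
    then have "degree P' < degree P" unfolding P' by (subst degree_mult_eq) auto
    from less.hyps[OF this \<open>P' \<noteq> 0\<close>] obtain zs P1 where *: "P' = (\<Prod>z\<leftarrow>zs. [:- z, 1:]) * P1"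
      "\<forall>z\<in>set zs. norm z = 1" "\<forall>z. norm z = 1 \<longrightarrow> poly P1 z \<noteq> 0"
      "length zs = (\<Sum>z | norm z = 1 \<and> poly P' z = 0. order z P')" by blast
    have "{z. norm z = 1 \<and> poly P z = 0} = insert w {z. norm z = 1 \<and> poly P' z = 0}"
      using w by (auto simp: P')
    then have "(\<Sum>z | norm z = 1 \<and> poly P z = 0. order z P)
       = (\<Sum>z\<in>insert w {z. norm z = 1 \<and> poly P' z = 0}. order z [:- w, 1:] + order z P')"
      by (rule sum.cong) (use less.prems in \<open>auto simp only: P' intro!: order_mult\<close>)
    also have "\<dots> = (\<Sum>z\<in>insert w {z. norm z = 1 \<and> poly P' z = 0}. if z = w then 1 else 0)
        + (\<Sum>z\<in>insert w {z. norm z = 1 \<and> poly P' z = 0}. order z P')"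
    proof -
      have "order z [:- w, 1:] = (if z = w then 1 else 0)" for z
        using order_power_n_n[of w 1] by (auto intro: order_0I)
      then show ?thesis by (simp only: sum.distrib)
    qed
    \<comment> \<open>If \<open>w\<close> is no longer a zero of \<open>P'\<close>, its order there
      is 0 and the extra point does not change the sum.\<close>
    also have "(\<Sum>z\<in>insert w {z. norm z = 1 \<and> poly P' z = 0}. order z P') = (\<Sum>z | norm z = 1 \<and> poly P' z = 0. order z P')"
      using poly_roots_finite[OF \<open>P' \<noteq> 0\<close>] by (cases "poly P' w = 0") (auto simp: insert_absorb w order_0I)
    also have "(\<Sum>z\<in>insert w {z. norm z = 1 \<and> poly P' z = 0}. if z = w then 1 else 0) = (1::nat)"
      using poly_roots_finite[OF \<open>P' \<noteq> 0\<close>] by (subst sum.delta) auto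
    finally have "length (w # zs) = (\<Sum>z | norm z = 1 \<and> poly P z = 0. order z P)" using *(4) by simp
    moreover have "P = (\<Prod>z\<leftarrow>w # zs. [:- z, 1:]) * P1"
      unfolding P' *(1) by (simp only: list.map prod_list.Cons mult.assoc)
    moreover have "\<forall>z\<in>set (w # zs). norm z = 1" using * w by simp
    ultimately show ?thesis using *(3) by blast
  qed
qed

text \<open>Write \<open>P = Q * P1\<close>. Up to explicit phases \<open>P\<close> and
  \<open>Q\<close> are real on the circle, hence so is \<open>P1\<close>; having no unimodular zero,
  it keeps one sign. In \<open>P * Q = Q\<^sup>2 * P1\<close> the real part of \<open>Q\<close>
  enters squared, so only an explicit phase remains.\<close>

lemma constant_phase:
  fixes P :: "complex poly"
  assumes "P \<noteq> 0"
    and real: "\<And>\<theta>. poly P (cis (2 * \<theta>)) = cis (real n * \<theta>) * of_real (W \<theta>)"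
  shows "\<exists>Q \<kappa> M. lead_coeff Q = 1 \<and> degree Q = (\<Sum>z | norm z = 1 \<and> poly P z = 0. order z P)
     \<and> (\<forall>z. norm z = 1 \<longrightarrow> norm (poly Q z) \<le> 2 ^ degree Q) \<and> norm \<kappa> = 1
     \<and> (\<forall>z. norm z = 1 \<longrightarrow> poly (P * Q) z = \<kappa> * z ^ M * of_real (norm (poly (P * Q) z)))"
proof -
  obtain zs P1 where P: "P = (\<Prod>z\<leftarrow>zs. [:- z, 1:]) * P1" and zs: "\<forall>z\<in>set zs. norm z = 1"
    and P1: "\<And>z. norm z = 1 \<Longrightarrow> poly P1 z \<noteq> 0"
    and len: "length zs = (\<Sum>z | norm z = 1 \<and> poly P z = 0. order z P)"
    using unimodular_factor[OF assms(1)] by blast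
  define Q where "Q = (\<Prod>z\<leftarrow>zs. [:- z, 1:])"
  define d where "d = length zs"
  have Q: "lead_coeff Q = 1" "degree Q = d"
    unfolding Q_def d_def by (rule monic_prod_linear)+
  then have "Q \<noteq> 0" by auto
  have Qb: "norm (poly Q z) \<le> 2 ^ d" if z: "norm z = 1" for z
    using zs unfolding Q_def d_def
  proof (induction zs)
    case (Cons w zs)
    have "norm (z - w) \<le> 2" using norm_triangle_ineq4[of z w] z Cons.prems by simp
    then have "norm (z - w) * norm (poly (\<Prod>z\<leftarrow>zs. [:- z, 1:]) z) \<le> 2 * 2 ^ length zs"
      using Cons by (intro mult_mono) auto
    then show ?case by (simp add: norm_mult flip: left_diff_distrib)
  qed simp
  obtain \<kappa>0 V where \<kappa>0: "norm \<kappa>0 = 1"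
    and V: "\<And>\<theta>. poly Q (cis (2 * \<theta>)) = \<kappa>0 * cis (real d * \<theta>) * of_real (V \<theta>)"
    using unimodular_roots_cis[of zs] zs unfolding Q_def d_def by blast
  \<comment> \<open>This is \<open>P1\<close> on the circle, rotated so that it should be
    real.\<close>
  define U where "U \<theta> = \<kappa>0 * cis ((real d - real n) * \<theta>) * poly P1 (cis (2 * \<theta>))" for \<theta>
  have U0: "U \<theta> \<noteq> 0" for \<theta>
    using \<kappa>0 P1[of "cis (2 * \<theta>)"] by (auto simp: U_def)
  have contU: "continuous_on UNIV U"
    unfolding U_def cis_conv_exp by (intro continuous_intros)
  have VU: "of_real (V \<theta>) * U \<theta> = of_real (W \<theta>)" for \<theta>
  proof -
    have "cis (real n * \<theta>) * of_real (W \<theta>) = \<kappa>0 * cis (real d * \<theta>) * of_real (V \<theta>) * poly P1 (cis (2 * \<theta>))"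
      using real[of \<theta>] V[of \<theta>] by (simp add: P flip: Q_def)
    also have "cis (real d * \<theta>) = cis (real n * \<theta>) * cis ((real d - real n) * \<theta>)"
      by (simp add: cis_mult algebra_simps)
    finally have "cis (real n * \<theta>) * of_real (W \<theta>) = cis (real n * \<theta>) * (of_real (V \<theta>) * U \<theta>)"
      by (simp only: U_def mult_ac)
    then show ?thesis by (subst (asm) mult_cancel_left) auto
  qed
  \<comment> \<open>Since \<open>V * U\<close> is real, a nonzero imaginary part of \<open>U\<close>
    would persist nearby and force \<open>V\<close>, hence \<open>Q\<close>, to vanish on an
    arc.\<close>
  have ImU: "Im (U \<theta>) = 0" for \<theta>
  proof (rule ccontr)
    assume *: "Im (U \<theta>) \<noteq> 0"
    have "open {t. Im (U t) \<noteq> 0}"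
      by (intro open_Collect_neq continuous_intros continuous_on_subset[OF contU]) auto
    with * obtain e where e: "e > 0" "ball \<theta> e \<subseteq> {t. Im (U t) \<noteq> 0}"
      unfolding open_contains_ball by blast
    have "poly Q (cis (2 * t)) = 0" if "t \<in> ball \<theta> e" for t
    proof -
      have "Im (U t) \<noteq> 0" using e that by auto
      moreover have "V t * Im (U t) = 0" using arg_cong[OF VU[of t], of Im] by simp
      ultimately show ?thesis by (simp add: V)
    qed
    then have "(\<lambda>t. cis (2 * t)) ` ball \<theta> e \<subseteq> {z. poly Q z = 0}" by blast
    then have "finite ((\<lambda>t. cis (2 * t)) ` ball \<theta> e)"
      using poly_roots_finite[OF \<open>Q \<noteq> 0\<close>] finite_subset by blast
    then show False using infinite_cis_ball[OF e(1)] by blast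
  qed
  have "(\<forall>t. Re (U t) > 0) \<or> (\<forall>t. Re (U t) < 0)"
  proof (rule ccontr)
    assume "\<not> ?thesis"
    then obtain s t where "Re (U s) \<le> 0" "Re (U t) \<ge> 0" by (auto simp: not_less)
    moreover have "connected (range (\<lambda>t. Re (U t)))"
      by (intro connected_continuous_image continuous_intros contU) auto
    ultimately have "0 \<in> range (\<lambda>t. Re (U t))"
      unfolding connected_iff_interval by blast
    then obtain x where "Re (U x) = 0" by auto
    then have "U x = 0" using ImU[of x] by (simp add: complex_eq_iff)
    then show False using U0 by blast
  qed
  then obtain \<epsilon> :: real where \<epsilon>: "\<bar>\<epsilon>\<bar> = 1" "\<And>t. U t = of_real (\<epsilon> * norm (U t))"
  proof
    assume *: "\<forall>t. Re (U t) > 0"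
    have "U t = of_real (1 * norm (U t))" for t
      using *[rule_format, of t] ImU[of t] by (simp add: complex_eq_iff cmod_def)
    then show ?thesis using that[of 1] by simp
  next
    assume *: "\<forall>t. Re (U t) < 0"
    have "U t = of_real (-1 * norm (U t))" for t
      using *[rule_format, of t] ImU[of t] by (simp add: complex_eq_iff cmod_def)
    then show ?thesis using that[of "-1"] by simp
  qed
  define \<kappa> where "\<kappa> = \<kappa>0 * of_real \<epsilon>"
  have \<kappa>: "norm \<kappa> = 1" using \<kappa>0 \<epsilon> by (simp add: \<kappa>_def norm_mult)
  have PQ: "poly (P * Q) (cis (2 * t)) = \<kappa> * cis (real (n + d) * t) * of_real (norm (poly (P * Q) (cis (2 * t))))" for t
  proof -
    have "poly (P * Q) (cis (2 * t)) = \<kappa>0 * (cis (real n * t) * cis (real d * t)) * (of_real ((V t)\<^sup>2) * U t)"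
      unfolding poly_mult real V VU[symmetric] by (simp only: power2_eq_square of_real_mult mult_ac)
    also have "cis (real n * t) * cis (real d * t) = cis (real (n + d) * t)"
      by (simp add: cis_mult algebra_simps)
    also have "of_real ((V t)\<^sup>2) * U t = of_real \<epsilon> * of_real ((V t)\<^sup>2 * norm (U t))"
      by (subst \<epsilon>(2)) simp
    finally have eq: "poly (P * Q) (cis (2 * t)) = \<kappa> * cis (real (n + d) * t) * of_real ((V t)\<^sup>2 * norm (U t))"
      by (simp add: \<kappa>_def mult_ac)
    then have "norm (poly (P * Q) (cis (2 * t))) = (V t)\<^sup>2 * norm (U t)"
      by (simp only: norm_mult \<kappa> norm_cis norm_of_real abs_mult abs_norm_cancel abs_power2 mult_1)
    with eq show ?thesis by simp
  qed
  \<comment> \<open>The half angles \<open>t\<close> and \<open>t + pi\<close> describe the same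
    point \<open>z\<close>, so comparing the phases at a point where \<open>P * Q\<close> does not
    vanish gives \<open>cis ((n + d) * pi) = 1\<close>. Evenness turns the half-angle phase into an
    integral power of \<open>z\<close>.\<close>
  have "even (n + d)"
  proof -
    have "P * Q \<noteq> 0" using assms(1) \<open>Q \<noteq> 0\<close> by simp
    then have "finite {z. poly (P * Q) z = 0}" by (rule poly_roots_finite)
    then have "\<not> (\<lambda>t. cis (2 * t)) ` ball 0 1 \<subseteq> {z. poly (P * Q) z = 0}"
      using infinite_cis_ball[OF zero_less_one, of 0] by (blast dest: finite_subset)
    then obtain x where x: "poly (P * Q) (cis (2 * x)) \<noteq> 0" by blast
    define z where "z = cis (2 * x)"
    have z: "norm z = 1" "poly (P * Q) z \<noteq> 0" using x by (simp_all add: z_def)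
    define t where "t = Arg z / 2"
    have zt: "z = cis (2 * t)" unfolding t_def by (rule unimodular_cis[OF z(1)])
    have zt': "z = cis (2 * (t + pi))" unfolding zt by (simp add: distrib_left complex_eq_iff)
    have "cis (real (n + d) * t) = cis (real (n + d) * (t + pi))"
    proof -
      have "\<kappa> * cis (real (n + d) * t) * of_real (norm (poly (P * Q) z)) = \<kappa> * cis (real (n + d) * (t + pi)) * of_real (norm (poly (P * Q) z))"
        using PQ[of t] PQ[of "t + pi"] unfolding zt[symmetric] zt'[symmetric] by argo
      then show ?thesis using z(2) \<kappa> by auto
    qed
    also have "\<dots> = cis (real (n + d) * t) * cis (real (n + d) * pi)"
      by (simp add: cis_mult algebra_simps)
    finally have "cis (real (n + d) * pi) = 1"
      by simp
    then have "cis pi ^ (n + d) = 1" by (simp only: Complex.DeMoivre)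
    then show ?thesis by (auto simp: minus_one_power_iff split: if_splits)
  qed
  then obtain M where M: "n + d = 2 * M" by (rule evenE)
  have "poly (P * Q) z = \<kappa> * z ^ M * of_real (norm (poly (P * Q) z))" if "norm z = 1" for z
  proof -
    define t where "t = Arg z / 2"
    have zt: "z = cis (2 * t)" unfolding t_def by (rule unimodular_cis[OF that])
    have "cis (real (n + d) * t) = z ^ M"
      unfolding M zt Complex.DeMoivre by (simp add: mult_ac)
    then show ?thesis using PQ[of t] by (simp only: zt)
  qed
  then show ?thesis using Q Qb \<kappa> len unfolding d_def by (intro exI[of _ Q] exI[of _ \<kappa>] exI[of _ M]) auto
qed

subsection \<open>Sparseness and periodicity\<close>

lemma coeff_mult_degree_le:
  fixes p Q :: "complex poly"
  assumes "degree Q \<le> d"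
  shows "coeff (p * Q) m = (\<Sum>i\<le>d. coeff Q i * (if i \<le> m then coeff p (m - i) else 0))"
proof -
  have "coeff (p * Q) m = (\<Sum>i\<le>m. coeff Q i * (if i \<le> m then coeff p (m - i) else 0))"
    by (subst mult.commute) (simp add: coeff_mult)
  also have "\<dots> = (\<Sum>i\<le>m + d. coeff Q i * (if i \<le> m then coeff p (m - i) else 0))"
    by (rule sum.mono_neutral_left) auto
  also have "\<dots> = (\<Sum>i\<le>d. coeff Q i * (if i \<le> m then coeff p (m - i) else 0))"
    by (rule sum.mono_neutral_right) (use assms in \<open>auto simp: coeff_eq_0\<close>)
  finally show ?thesis .
qed

lemma bounded_family_subsequence:
  fixes f :: "nat \<Rightarrow> nat \<Rightarrow> complex"
  assumes "\<And>i j. norm (f i j) \<le> R"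
  shows "\<exists>g l. strict_mono (g :: nat \<Rightarrow> nat) \<and> (\<forall>j<d. (\<lambda>i. f (g i) j) \<longlonglongrightarrow> l j)"
proof (induction d)
  case 0
  show ?case by (intro exI[of _ id]) (auto simp: strict_mono_def)
next
  case (Suc d)
  then obtain g l where g: "strict_mono g" "\<forall>j<d. (\<lambda>i. f (g i) j) \<longlonglongrightarrow> l j" by blast
  have "\<forall>i. f (g i) d \<in> cball 0 R" using assms by simp
  then obtain a h where h: "strict_mono (h :: nat \<Rightarrow> nat)" "((\<lambda>i. f (g i) d) \<circ> h) \<longlonglongrightarrow> a"
    using compact_cball[of "0 :: complex" R] unfolding compact_def by meson
  have "(\<lambda>i. f ((g \<circ> h) i) j) \<longlonglongrightarrow> (l(d := a)) j" if "j < Suc d" for j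
  proof (cases "j = d")
    case True
    then show ?thesis using h(2) by (simp add: o_def)
  next
    case False
    then have "((\<lambda>i. f (g i) j) \<circ> h) \<longlonglongrightarrow> l j"
      using g(2) that h(1) by (intro LIMSEQ_subseq_LIMSEQ) auto
    then show ?thesis using False by (simp add: o_def)
  qed
  then show ?case using strict_mono_o[OF g(1) h(1)] by blast
qed

lemma finite_set_gap:
  fixes V :: "'a :: real_normed_vector set"
  assumes "finite V"
  shows "\<exists>\<delta>>0. \<forall>v\<in>V. v \<noteq> 0 \<longrightarrow> \<delta> \<le> norm v"
proof -
  \<comment> \<open>The element 1 covers the case that \<open>V\<close> has no nonzero
    element.\<close>
  define \<delta> where "\<delta> = Min (insert 1 (norm ` (V - {0})))"
  have fin: "finite (insert 1 (norm ` (V - {0})))" using assms by simp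
  have "\<delta> \<in> insert 1 (norm ` (V - {0}))"
    unfolding \<delta>_def using fin by (rule Min_in) simp
  then have "\<delta> > 0" by auto
  moreover have "\<forall>v\<in>V. v \<noteq> 0 \<longrightarrow> \<delta> \<le> norm v"
    unfolding \<delta>_def using fin by (intro ballI impI Min_le) auto
  ultimately show ?thesis by blast
qed

text \<open>Along a subsequence the multipliers converge to a monic \<open>L\<close>. The
  coefficients of \<open>p i * L\<close> range over a finite set, so the nonzero ones are at least
  some \<open>\<delta>\<close>; by closeness, the coefficients of \<open>p i * q i\<close> exceed
  \<open>\<delta> / 2\<close> at the same places and are at most \<open>\<eta>\<close> elsewhere.
  Then \<open>few_large_coeffs\<close> applies.\<close>

lemma sparse_multiple:
  fixes p :: "nat \<Rightarrow> complex poly" and T :: "complex set"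
  assumes "finite T" and T: "\<And>i j. coeff (p i) j \<in> T"
    and ex: "\<And>i. \<exists>Q \<kappa> M. lead_coeff Q = 1 \<and> degree Q \<le> k
     \<and> (\<forall>z. norm z = 1 \<longrightarrow> norm (poly Q z) \<le> 2 ^ degree Q) \<and> norm \<kappa> = 1
     \<and> (\<forall>z. norm z = 1 \<longrightarrow> poly (p i * Q) z = \<kappa> * z ^ M * of_real (norm (poly (p i * Q) z)))"
  shows "\<exists>Q B g. strict_mono (g :: nat \<Rightarrow> nat) \<and> lead_coeff Q = 1 \<and> (\<forall>i. card {j. coeff (p (g i) * Q) j \<noteq> 0} \<le> B)"
proof -
  have "\<forall>i. \<exists>X. lead_coeff (fst X) = 1 \<and> degree (fst X) \<le> k
     \<and> (\<forall>z. norm z = 1 \<longrightarrow> norm (poly (fst X) z) \<le> 2 ^ degree (fst X)) \<and> norm (fst (snd X)) = 1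
     \<and> (\<forall>z. norm z = 1 \<longrightarrow> poly (p i * fst X) z = fst (snd X) * z ^ snd (snd X) * of_real (norm (poly (p i * fst X) z)))"
    using ex by (auto simp: split_paired_Ex)
  then obtain X where X: "\<forall>i. lead_coeff (fst (X i)) = 1 \<and> degree (fst (X i)) \<le> k
     \<and> (\<forall>z. norm z = 1 \<longrightarrow> norm (poly (fst (X i)) z) \<le> 2 ^ degree (fst (X i))) \<and> norm (fst (snd (X i))) = 1
     \<and> (\<forall>z. norm z = 1 \<longrightarrow> poly (p i * fst (X i)) z = fst (snd (X i)) * z ^ snd (snd (X i)) * of_real (norm (poly (p i * fst (X i)) z)))"
    by metis
  define Q \<kappa> M where "Q = (\<lambda>i. fst (X i))" and "\<kappa> = (\<lambda>i. fst (snd (X i)))" and "M = (\<lambda>i. snd (snd (X i)))"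
  have Q: "lead_coeff (Q i) = 1" "degree (Q i) \<le> k" "\<And>z. norm z = 1 \<Longrightarrow> norm (poly (Q i) z) \<le> 2 ^ degree (Q i)"
    "norm (\<kappa> i) = 1" "\<And>z. norm z = 1 \<Longrightarrow> poly (p i * Q i) z = \<kappa> i * z ^ M i * of_real (norm (poly (p i * Q i) z))" for i
    using X unfolding Q_def \<kappa>_def M_def by blast+
  have Qb: "norm (coeff (Q i) j) \<le> 2 ^ k" for i j
  proof -
    have "norm (poly (Q i) z) \<le> 2 ^ k" if "norm z = 1" for z
      using Q(3)[OF that, of i] power_increasing[OF Q(2)[of i], of "2 :: real"] by linarith
    then show ?thesis by (rule norm_coeff_le)
  qed
  \<comment> \<open>The degree is made constant first, so that the limit keeps leading coefficient
    1.\<close>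
  have "finite ((\<lambda>i. degree (Q i)) ` UNIV)"
    by (rule finite_subset[of _ "{..k}"]) (use Q in auto)
  then have "\<exists>i0. infinite {i \<in> UNIV. degree (Q i) = degree (Q i0)}"
    using pigeonhole_infinite[of "UNIV :: nat set" "\<lambda>i. degree (Q i)"] by auto
  then obtain d where "infinite {i. degree (Q i) = d}" by auto
  then obtain g1 :: "nat \<Rightarrow> nat" where g1: "strict_mono g1" "\<And>i. degree (Q (g1 i)) = d"
    using infinite_enumerate by blast
  obtain g2 l where g2: "strict_mono (g2 :: nat \<Rightarrow> nat)" "\<And>j. j < Suc d \<Longrightarrow> (\<lambda>i. coeff (Q (g1 (g2 i))) j) \<longlonglongrightarrow> l j"
    using bounded_family_subsequence[of "\<lambda>i j. coeff (Q (g1 i)) j" "2 ^ k" "Suc d"] Qb by auto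
  define q where "q i = Q (g1 (g2 i))" for i
  define p' where "p' i = p (g1 (g2 i))" for i
  have dq: "degree (q i) = d" for i by (simp add: q_def g1)
  have ld: "l d = 1"
  proof -
    have "coeff (q i) d = 1" for i using Q(1)[of "g1 (g2 i)"] dq[of i] by (simp add: q_def)
    then have "(\<lambda>i. 1) \<longlonglongrightarrow> l d" using g2(2)[of d] by (simp add: q_def)
    then show ?thesis by (simp add: LIMSEQ_const_iff)
  qed
  define L where "L = (\<Sum>j\<le>d. monom (l j) j)"
  have cL: "coeff L j = (if j \<le> d then l j else 0)" for j
    by (simp add: L_def coeff_sum)
  have dL: "degree L = d"
    by (rule antisym) (auto intro!: degree_le le_degree simp: cL ld)
  obtain R where R: "R \<ge> 0" "\<And>t. t \<in> insert 0 T \<Longrightarrow> norm t \<le> R"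
  proof -
    have "bounded (insert 0 T)" using assms(1) by (simp add: finite_imp_bounded)
    then show ?thesis using that unfolding bounded_iff by (metis insertI1 norm_zero)
  qed
  \<comment> \<open>The default 0 accounts for indices below the constant term and is the reason for
    working with \<open>insert 0 T\<close>.\<close>
  define w where "w i m j = (if j \<le> m then coeff (p' i) (m - j) else 0)" for i m j
  have w: "w i m j \<in> insert 0 T" for i m j using T by (simp add: w_def p'_def)
  have cpL: "coeff (p' i * L) m = (\<Sum>j\<le>d. l j * w i m j)" for i m
    by (subst coeff_mult_degree_le[of L d]) (simp_all add: dL cL w_def)
  have cpq: "coeff (p' i * q i) m = (\<Sum>j\<le>d. coeff (q i) j * w i m j)" for i m
    by (subst coeff_mult_degree_le[of "q i" d]) (simp_all add: dq w_def)
  define Vals where "Vals = (\<lambda>v. \<Sum>j\<le>d. l j * v j) ` (PiE {..d} (\<lambda>_. insert 0 T))"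
  have "finite Vals" unfolding Vals_def using assms(1) by (intro finite_imageI finite_PiE) auto
  then obtain \<delta> where \<delta>: "\<delta> > 0" "\<And>v. v \<in> Vals \<Longrightarrow> v \<noteq> 0 \<Longrightarrow> \<delta> \<le> norm v"
    using finite_set_gap[of Vals] by blast
  have Vals: "coeff (p' i * L) m \<in> Vals" for i m
    unfolding Vals_def cpL
    by (rule image_eqI[of _ _ "restrict (w i m) {..d}"]) (use w in \<open>auto intro!: sum.cong\<close>)
  define C where "C = (\<Sum>j\<le>d. 2 ^ k * R)"
  obtain K \<eta> where \<eta>: "\<eta> > 0" and K: "\<And>(F :: complex poly) \<kappa> M \<Lambda>. norm \<kappa> = 1 \<Longrightarrow>
     (\<forall>z. norm z = 1 \<longrightarrow> poly F z = \<kappa> * z ^ M * of_real (norm (poly F z))) \<Longrightarrow>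
     norm (coeff F M) \<le> C \<Longrightarrow> (\<forall>x\<in>\<Lambda>. \<delta> / 2 \<le> norm (coeff F x)) \<Longrightarrow>
     (\<forall>x. x \<notin> \<Lambda> \<longrightarrow> norm (coeff F x) \<le> \<eta>) \<Longrightarrow> card \<Lambda> < K"
    using few_large_coeffs[of "\<delta> / 2" C] \<delta>(1) by (metis half_gt_zero)
  have "(\<lambda>i. \<Sum>j\<le>d. norm (coeff (q i) j - l j) * R) \<longlonglongrightarrow> (\<Sum>j\<le>d. norm (l j - l j) * R)"
    unfolding q_def by (intro tendsto_intros g2(2)) auto
  then have "(\<lambda>i. \<Sum>j\<le>d. norm (coeff (q i) j - l j) * R) \<longlonglongrightarrow> 0" by simp
  then have "eventually (\<lambda>i. (\<Sum>j\<le>d. norm (coeff (q i) j - l j) * R) < min \<eta> (\<delta> / 2)) sequentially"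
    by (rule order_tendstoD) (use \<eta> \<delta> in simp)
  then obtain I where I: "\<And>i. i \<ge> I \<Longrightarrow> (\<Sum>j\<le>d. norm (coeff (q i) j - l j) * R) < min \<eta> (\<delta> / 2)"
    unfolding eventually_sequentially by blast
  have main: "card {m. coeff (p' i * L) m \<noteq> 0} < K" if "i \<ge> I" for i
  proof (rule K[where F = "p' i * q i" and \<kappa> = "\<kappa> (g1 (g2 i))" and M = "M (g1 (g2 i))"])
    have diff: "norm (coeff (p' i * q i) m - coeff (p' i * L) m) < min \<eta> (\<delta> / 2)" for m
    proof -
      have "coeff (p' i * q i) m - coeff (p' i * L) m = (\<Sum>j\<le>d. (coeff (q i) j - l j) * w i m j)"
        unfolding cpq cpL by (simp add: sum_subtractf left_diff_distrib)
      also have "norm \<dots> \<le> (\<Sum>j\<le>d. norm (coeff (q i) j - l j) * R)"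
        using R(2)[OF w] by (intro sum_norm_le) (auto simp: norm_mult intro!: mult_left_mono)
      finally show ?thesis using I[OF that] by linarith
    qed
    show "\<forall>x\<in>{m. coeff (p' i * L) m \<noteq> 0}. \<delta> / 2 \<le> norm (coeff (p' i * q i) x)"
    proof
      fix m assume "m \<in> {m. coeff (p' i * L) m \<noteq> 0}"
      then have "\<delta> \<le> norm (coeff (p' i * L) m)" using \<delta>(2)[OF Vals] by simp
      moreover have "norm (coeff (p' i * L) m) \<le> norm (coeff (p' i * q i) m) + norm (coeff (p' i * q i) m - coeff (p' i * L) m)"
        using norm_triangle_sub[of "coeff (p' i * L) m" "coeff (p' i * q i) m"] by (simp add: norm_minus_commute)
      moreover have "norm (coeff (p' i * q i) m - coeff (p' i * L) m) < \<delta> / 2" using diff[of m] by simp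
      ultimately show "\<delta> / 2 \<le> norm (coeff (p' i * q i) m)" by linarith
    qed
    show "\<forall>x. x \<notin> {m. coeff (p' i * L) m \<noteq> 0} \<longrightarrow> norm (coeff (p' i * q i) x) \<le> \<eta>"
    proof (intro allI impI)
      fix m assume "m \<notin> {m. coeff (p' i * L) m \<noteq> 0}"
      then have "coeff (p' i * L) m = 0" by simp
      then show "norm (coeff (p' i * q i) m) \<le> \<eta>" using diff[of m] by simp
    qed
    have "norm (coeff (p' i * q i) m) \<le> C" for m
      unfolding cpq C_def using R(2)[OF w] Qb R(1)
      by (intro sum_norm_le) (auto simp: norm_mult q_def intro!: mult_mono)
    then show "norm (coeff (p' i * q i) (M (g1 (g2 i)))) \<le> C" .
  qed (use Q in \<open>auto simp: q_def p'_def simp del: poly_mult\<close>)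
  \<comment> \<open>Shifting by \<open>I\<close> discards the initial terms, where the approximation
    is not yet close enough.\<close>
  have "strict_mono (\<lambda>i. g1 (g2 (i + I)))"
    using g1(1) g2(1) by (auto simp: strict_mono_def)
  moreover have "lead_coeff L = 1" by (simp add: dL cL ld)
  moreover have "card {j. coeff (p (g1 (g2 (i + I))) * L) j \<noteq> 0} \<le> K" for i
    using main[of "i + I"] by (simp add: p'_def)
  ultimately show ?thesis by (intro exI[of _ L] exI[of _ K] exI[of _ "\<lambda>i. g1 (g2 (i + I))"]) auto
qed

text \<open>There are at most \<open>\<sigma>\<close> windows of \<open>d + 1\<close> consecutive
  values, so two of \<open>\<sigma> + 1\<close> windows agree. Since each value is determined by
  those after it, the agreement propagates downwards and yields a period at most
  \<open>\<sigma>\<close>; its multiple \<open>fact \<sigma>\<close> does not depend on the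
  sequence.\<close>

lemma recurrence_periodic:
  fixes a :: "nat \<Rightarrow> 'a" and T :: "'a set"
  assumes "finite T" and aT: "\<And>j. a j \<in> T"
    and det: "\<And>m m'. lo \<le> m \<Longrightarrow> m \<le> hi \<Longrightarrow> lo \<le> m' \<Longrightarrow> m' \<le> hi \<Longrightarrow>
        (\<And>j. j \<le> d \<Longrightarrow> a (m + 1 + j) = a (m' + 1 + j)) \<Longrightarrow> a m = a m'"
    and \<sigma>: "\<sigma> = card T ^ (d + 1)" and m: "lo + fact \<sigma> \<le> m" "m + \<sigma> \<le> hi"
  shows "a m = a (m - fact \<sigma>)"
proof -
  \<comment> \<open>Windows are numbered downwards from \<open>m + \<sigma>\<close>: window
    \<open>\<sigma>\<close> starts at \<open>m\<close>, and window
    \<open>\<sigma> + fact \<sigma>\<close> at \<open>m - fact \<sigma>\<close>.\<close>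
  define win where "win t = restrict (\<lambda>j. a (m + \<sigma> - t + j)) {..d}" for t
  have "win ` {..\<sigma>} \<subseteq> PiE {..d} (\<lambda>_. T)" using aT by (auto simp only: win_def restrict_PiE_iff image_subset_iff)
  then have "card (win ` {..\<sigma>}) \<le> card (PiE {..d} (\<lambda>_. T))"
    using assms(1) by (intro card_mono finite_PiE) auto
  also have "\<dots> = \<sigma>" by (simp add: card_PiE \<sigma>)
  finally have "\<not> inj_on win {..\<sigma>}" by (auto simp: card_image)
  then obtain t e where te: "e \<ge> 1" "t + e \<le> \<sigma>" "win t = win (t + e)"
  proof -
    obtain x y where "x \<le> \<sigma>" "y \<le> \<sigma>" "win x = win y" "x \<noteq> y"
      using \<open>\<not> inj_on win {..\<sigma>}\<close> by (auto simp: inj_on_def)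
    then show ?thesis
      using that[of "y - x" x] that[of "x - y" y] by (cases "x < y") auto
  qed
  \<comment> \<open>Moving both windows down by one position adds one value, which
    \<open>det\<close> shows to be equal for the two.\<close>
  have step: "win (t + s) = win (t + e + s)" if "t + e + s \<le> \<sigma> + fact \<sigma>" for s
    using that
  proof (induction s)
    case (Suc s)
    then have IH: "win (t + s) = win (t + e + s)" by simp
    define x y where "x = m + \<sigma> - (t + Suc s)" and "y = m + \<sigma> - (t + e + Suc s)"
    have xy: "m + \<sigma> - (t + s) = x + 1" "m + \<sigma> - (t + e + s) = y + 1"
      using Suc.prems m by (auto simp: x_def y_def)
    have eq: "a (x + 1 + j) = a (y + 1 + j)" if "j \<le> d" for j
      using fun_cong[OF IH, of j] that unfolding win_def xy by simp
    have "a x = a y"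
      by (rule det) (use Suc.prems m eq in \<open>auto simp: x_def y_def\<close>)
    moreover have "a (x + j) = a (y + j)" if "j \<le> d" "j \<noteq> 0" for j
      using eq[of "j - 1"] that by simp
    ultimately have "a (x + j) = a (y + j)" if "j \<le> d" for j
      using that by (cases "j = 0") auto
    then show ?case unfolding win_def x_def y_def by (intro restrict_ext) simp
  qed (use te in simp)
  have iter: "win \<sigma> = win (\<sigma> + n * e)" if "n * e \<le> fact \<sigma>" for n
    using that
  proof (induction n)
    case (Suc n)
    have "win (t + (\<sigma> - t + n * e)) = win (t + e + (\<sigma> - t + n * e))"
      by (rule step) (use Suc.prems te in auto)
    then show ?case using Suc te by (simp add: algebra_simps)
  qed simp
  have "e dvd fact \<sigma>" using te by (intro dvd_fact) auto
  then obtain n where "fact \<sigma> = n * e" by (metis dvdE mult.commute)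
  then have "win \<sigma> = win (\<sigma> + fact \<sigma>)" using iter[of n] by simp
  from fun_cong[OF this, of 0] show ?thesis by (simp add: win_def)
qed

text \<open>Where \<open>P * Q\<close> has a long run of zero coefficients, those of
  \<open>P\<close> satisfy the recurrence given by the monic \<open>Q\<close> and are periodic with
  period \<open>p\<close>, so \<open>(1 - monom 1 p) * P\<close> has zero coefficients
  there.\<close>

lemma sparse_periodic:
  fixes T :: "complex set"
  assumes "finite T" "lead_coeff Q = 1"
  shows "\<exists>p c. p \<ge> 1 \<and> (\<forall>P. (\<forall>j. coeff P j \<in> T) \<longrightarrow>
     card {j. coeff ((1 - monom 1 p) * P) j \<noteq> 0} \<le> p + card {j. coeff (P * Q) j \<noteq> 0} * c)"
proof -
  define d where "d = degree Q"
  define \<sigma> where "\<sigma> = card T ^ (d + 1)"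
  define p where "p = (fact \<sigma> :: nat)"
  have "card {j. coeff ((1 - monom 1 p) * P) j \<noteq> 0} \<le> p + card {j. coeff (P * Q) j \<noteq> 0} * (p + \<sigma> + d + 1)"
    if P: "\<And>j. coeff P j \<in> T" for P
  proof -
    define \<Lambda> where "\<Lambda> = {j. coeff (P * Q) j \<noteq> 0}"
    have fin: "finite \<Lambda>" by (simp add: \<Lambda>_def finite_supp)
    \<comment> \<open>Periodicity at \<open>m\<close> uses the vanishing of \<open>P * Q\<close>
      from \<open>m - p\<close> to \<open>m + \<sigma> + d\<close>; the interval around
      \<open>b\<close> consists of the \<open>m\<close> for which \<open>b\<close> lies in that
      range.\<close>
    have "{j. coeff ((1 - monom 1 p) * P) j \<noteq> 0} \<subseteq> {..<p} \<union> (\<Union>b\<in>\<Lambda>. {b - (\<sigma> + d)..b + p})"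
    proof
      fix m assume "m \<in> {j. coeff ((1 - monom 1 p) * P) j \<noteq> 0}"
      then have m: "coeff P m - (if m < p then 0 else coeff P (m - p)) \<noteq> 0"
        by (cases "m < p") (simp_all add: left_diff_distrib coeff_monom_mult)
      show "m \<in> {..<p} \<union> (\<Union>b\<in>\<Lambda>. {b - (\<sigma> + d)..b + p})"
      proof (rule ccontr)
        assume *: "m \<notin> {..<p} \<union> (\<Union>b\<in>\<Lambda>. {b - (\<sigma> + d)..b + p})"
        then have mp: "p \<le> m" by auto
        have zero: "coeff (P * Q) j = 0" if "m - p \<le> j" "j \<le> m + \<sigma> + d" for j
        proof (rule ccontr)
          assume "coeff (P * Q) j \<noteq> 0"
          then have "j \<in> \<Lambda>" by (simp add: \<Lambda>_def)
          with * have "m \<notin> {j - (\<sigma> + d)..j + p}" by blast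
          then show False using that by auto
        qed
        have "coeff P m = coeff P (m - fact \<sigma>)"
        proof (rule recurrence_periodic[where T = T and d = d and lo = "m - p" and hi = "m + \<sigma>"])
          fix x y
          assume xy: "m - p \<le> x" "x \<le> m + \<sigma>" "m - p \<le> y" "y \<le> m + \<sigma>"
            and eq: "\<And>j. j \<le> d \<Longrightarrow> coeff P (x + 1 + j) = coeff P (y + 1 + j)"
          \<comment> \<open>The coefficient of \<open>P * Q\<close> at \<open>x + d\<close>
            vanishes, and its term with \<open>i = d\<close> is \<open>coeff P x\<close> because
            \<open>Q\<close> is monic. The remaining terms involve only later coefficients.\<close>
          have rec: "coeff P x = - (\<Sum>i<d. coeff Q i * coeff P (x + 1 + (d - 1 - i)))"
            if "m - p \<le> x" "x \<le> m + \<sigma>" for x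
          proof -
            have "0 = (\<Sum>i\<le>d. coeff Q i * (if i \<le> x + d then coeff P (x + d - i) else 0))"
              using zero[of "x + d"] that by (subst coeff_mult_degree_le[symmetric]) (auto simp: d_def)
            also have "\<dots> = (\<Sum>i\<in>insert d {..<d}. coeff Q i * coeff P (x + d - i))"
              by (rule sum.cong) auto
            also have "\<dots> = coeff P x + (\<Sum>i<d. coeff Q i * coeff P (x + d - i))"
              using assms(2) by (simp add: d_def)
            also have "(\<Sum>i<d. coeff Q i * coeff P (x + d - i)) = (\<Sum>i<d. coeff Q i * coeff P (x + 1 + (d - 1 - i)))"
              by (rule sum.cong) (auto intro!: arg_cong[of _ _ "coeff P"])
            finally show ?thesis by (simp add: eq_neg_iff_add_eq_0)
          qed
          show "coeff P x = coeff P y"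
            unfolding rec[OF xy(1,2)] rec[OF xy(3,4)] by (intro arg_cong[of _ _ uminus] sum.cong refl arg_cong2[of _ _ _ _ "(*)"] eq) simp
        qed (use assms P mp in \<open>auto simp: \<sigma>_def p_def\<close>)
        then show False using m mp by (simp add: p_def split: if_splits)
      qed
    qed
    then have "card {j. coeff ((1 - monom 1 p) * P) j \<noteq> 0} \<le> card ({..<p} \<union> (\<Union>b\<in>\<Lambda>. {b - (\<sigma> + d)..b + p}))"
      by (intro card_mono) (use fin in auto)
    also have "\<dots> \<le> card {..<p} + card (\<Union>b\<in>\<Lambda>. {b - (\<sigma> + d)..b + p})"
      by (rule card_Un_le)
    also have "card (\<Union>b\<in>\<Lambda>. {b - (\<sigma> + d)..b + p}) \<le> (\<Sum>b\<in>\<Lambda>. card {b - (\<sigma> + d)..b + p})"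
      by (rule card_UN_le[OF fin])
    also have "\<dots> \<le> (\<Sum>b\<in>\<Lambda>. p + \<sigma> + d + 1)"
      by (rule sum_mono) auto
    also have "\<dots> = card \<Lambda> * (p + \<sigma> + d + 1)" by simp
    finally show ?thesis by (simp add: \<Lambda>_def)
  qed
  then show ?thesis by (intro exI[of _ p] exI[of _ "p + \<sigma> + d + 1"]) (auto simp: p_def fact_ge_1)
qed

subsection \<open>Zeros of sparse sums near the origin\<close>

lemma cis_has_integral:
  assumes "b \<noteq> 0" "\<alpha> \<le> \<beta>"
  shows "((\<lambda>\<theta>. cis (b * \<theta>)) has_integral (cis (b * \<beta>) - cis (b * \<alpha>)) / (\<i> * of_real b)) {\<alpha>..\<beta>}"
proof -
  have "((\<lambda>\<theta>. cis (b * \<theta>)) has_integral (cis (b * \<beta>) / (\<i> * of_real b) - cis (b * \<alpha>) / (\<i> * of_real b))) {\<alpha>..\<beta>}"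
  proof (rule fundamental_theorem_of_calculus[OF assms(2)])
    fix x
    have "((\<lambda>z. exp (\<i> * of_real b * z) / (\<i> * of_real b)) has_field_derivative exp (\<i> * of_real b * of_real x)) (at (of_real x))"
      using assms(1) by (auto intro!: derivative_eq_intros)
    then have "((\<lambda>\<theta>. exp (\<i> * of_real b * of_real \<theta>) / (\<i> * of_real b)) has_vector_derivative exp (\<i> * of_real b * of_real x)) (at x within {\<alpha>..\<beta>})"
      by (rule has_vector_derivative_real_field)
    then show "((\<lambda>\<theta>. cis (b * \<theta>) / (\<i> * of_real b)) has_vector_derivative cis (b * x)) (at x within {\<alpha>..\<beta>})"
      by (simp add: cis_conv_exp mult.assoc)
  qed
  then show ?thesis by (simp add: diff_divide_distrib)
qed

lemma continuous_on_cis_mult [continuous_intros]: "continuous_on A (\<lambda>\<theta>. cis (b * \<theta>))"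
  unfolding cis_conv_exp by (intro continuous_intros)

lemma norm_integral_cis_le:
  assumes "\<alpha> \<le> \<beta>" "\<bar>b\<bar> \<ge> \<nu>" "\<nu> > 0"
  shows "norm (integral {\<alpha>..\<beta>} (\<lambda>\<theta>. cis (b * \<theta>))) \<le> 2 / \<nu>"
proof -
  have b: "b \<noteq> 0" using assms by auto
  have "norm (integral {\<alpha>..\<beta>} (\<lambda>\<theta>. cis (b * \<theta>))) = norm (cis (b * \<beta>) - cis (b * \<alpha>)) / \<bar>b\<bar>"
    using integral_unique[OF cis_has_integral[OF b assms(1)]] by (simp add: norm_divide norm_mult)
  also have "\<dots> \<le> 2 / \<bar>b\<bar>"
    using norm_triangle_ineq4[of "cis (b * \<beta>)" "cis (b * \<alpha>)"] by (intro divide_right_mono) auto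
  also have "\<dots> \<le> 2 / \<nu>" using assms by (intro divide_left_mono) auto
  finally show ?thesis .
qed

text \<open>The \<open>N + 1\<close> open intervals between consecutive powers are disjoint, so at
  most \<open>N\<close> points leave one of them empty.\<close>

lemma gap_between_powers:
  fixes V :: "real set"
  assumes "finite V" "card V \<le> N" "\<Gamma> \<ge> 1"
  shows "\<exists>i\<le>N. \<forall>v\<in>V. v \<le> \<Gamma> ^ i \<or> \<Gamma> ^ Suc i \<le> v"
proof (rule ccontr)
  assume "\<not> ?thesis"
  then have "\<forall>i. \<exists>v. i \<le> N \<longrightarrow> v \<in> V \<and> \<Gamma> ^ i < v \<and> v < \<Gamma> ^ Suc i"
    by (meson not_le)
  then obtain v where v: "\<And>i. i \<le> N \<Longrightarrow> v i \<in> V" "\<And>i. i \<le> N \<Longrightarrow> \<Gamma> ^ i < v i" "\<And>i. i \<le> N \<Longrightarrow> v i < \<Gamma> ^ Suc i"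
    by metis
  have less: "v i < v j" if "i < j" "j \<le> N" for i j
  proof -
    have "v i < \<Gamma> ^ Suc i" using v(3) that by simp
    also have "\<dots> \<le> \<Gamma> ^ j" using that assms(3) by (intro power_increasing) auto
    also have "\<dots> < v j" using v(2) that by simp
    finally show ?thesis .
  qed
  have "inj_on v {..N}"
    by (rule inj_onI) (metis atMost_iff less less_irrefl linorder_neqE_nat)
  then have "card {..N} \<le> card V"
    using v(1) assms(1) by (intro card_inj_on_le[of v]) auto
  then show False using assms(2) by simp
qed

text \<open>Each \<open>lam m\<close> is moved by at most \<open>\<mu>\<close> to a representative
  common to its cluster, which is 0 for the low cluster. The sum over representatives vanishes
  because the high clusters have zero coefficient sum, so only the displacement counts.\<close>

lemma clustered_sum_bound:
  fixes lam r :: "'a \<Rightarrow> real"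
  assumes fin: "finite \<Lambda>" and "0 \<le> \<mu>" "2 * \<mu> < \<nu>"
    and gap: "\<And>m. m \<in> \<Lambda> \<Longrightarrow> \<bar>lam m\<bar> \<le> \<mu> \<or> \<nu> \<le> \<bar>lam m\<bar>"
      "\<And>m m'. m \<in> \<Lambda> \<Longrightarrow> m' \<in> \<Lambda> \<Longrightarrow> \<bar>lam m - lam m'\<bar> \<le> \<mu> \<or> \<nu> \<le> \<bar>lam m - lam m'\<bar>"
    and zero: "\<And>m. m \<in> \<Lambda> \<Longrightarrow> \<nu> \<le> \<bar>lam m\<bar> \<Longrightarrow> (\<Sum>m' | m' \<in> \<Lambda> \<and> \<bar>lam m' - lam m\<bar> \<le> \<mu>. r m') = 0"
  shows "\<bar>\<Sum>m\<in>\<Lambda>. r m * lam m\<bar> \<le> \<mu> * (\<Sum>m\<in>\<Lambda>. \<bar>r m\<bar>)"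
proof -
  define cl where "cl m = {m' \<in> \<Lambda>. \<bar>lam m' - lam m\<bar> \<le> \<mu>}" for m
  define rep where "rep m = (if \<bar>lam m\<bar> \<le> \<mu> then 0 else Min (lam ` cl m))" for m
  have fcl: "finite (cl m)" for m using fin by (simp add: cl_def)
  have rep_in: "\<exists>x\<in>cl m. rep m = lam x" if "m \<in> \<Lambda>" "\<not> \<bar>lam m\<bar> \<le> \<mu>" for m
  proof -
    have "m \<in> cl m" using that assms(2) by (simp add: cl_def)
    then have "Min (lam ` cl m) \<in> lam ` cl m" using fcl by (intro Min_in) auto
    then show ?thesis using that by (auto simp: rep_def)
  qed
  have near: "\<bar>lam m - rep m\<bar> \<le> \<mu>" if "m \<in> \<Lambda>" for m
  proof (cases "\<bar>lam m\<bar> \<le> \<mu>")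
    case False
    then show ?thesis using rep_in[OF that False] by (auto simp: cl_def abs_minus_commute)
  qed (simp add: rep_def)
  \<comment> \<open>Being within \<open>\<mu>\<close> is transitive on \<open>\<Lambda>\<close>:
    distances up to \<open>2 * \<mu>\<close> stay below \<open>\<nu>\<close> and hence are at most
    \<open>\<mu>\<close>.\<close>
  have cl_eq: "cl m = cl m'" if "m \<in> \<Lambda>" "m' \<in> \<Lambda>" "\<bar>lam m - lam m'\<bar> < \<nu>" for m m'
  proof -
    have "\<bar>lam m - lam m'\<bar> \<le> \<mu>" using gap(2)[OF that(1,2)] that(3) by linarith
    then have "x \<in> cl m \<longleftrightarrow> x \<in> cl m'" for x
      using gap(2)[of x m] gap(2)[of x m'] that assms(3) by (auto simp: cl_def)
    then show ?thesis by blast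
  qed
  \<comment> \<open>The representative 0 annihilates its fibre; any other fibre is exactly one high
    cluster.\<close>
  have fiber: "v * (\<Sum>m | m \<in> \<Lambda> \<and> rep m = v. r m) = 0" if "v \<in> rep ` \<Lambda>" for v
  proof (cases "v = 0")
    case False
    from that obtain m0 where m0: "m0 \<in> \<Lambda>" "v = rep m0" by blast
    then have high: "\<not> \<bar>lam m0\<bar> \<le> \<mu>" using False by (auto simp: rep_def)
    obtain y where y: "y \<in> cl m0" "v = lam y" using rep_in[OF m0(1) high] m0(2) by auto
    have "{m \<in> \<Lambda>. rep m = v} = cl m0"
    proof (intro subset_antisym subsetI)
      fix m assume m: "m \<in> {m \<in> \<Lambda>. rep m = v}"
      then have "\<bar>lam m - v\<bar> \<le> \<mu>" using near[of m] by auto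
      then have "\<bar>lam m - lam m0\<bar> < \<nu>" using y assms(3) by (auto simp: cl_def)
      then show "m \<in> cl m0" using gap(2)[of m m0] m m0(1) by (auto simp: cl_def)
    next
      fix m assume m: "m \<in> cl m0"
      then have m': "m \<in> \<Lambda>" "\<bar>lam m - lam m0\<bar> \<le> \<mu>" by (auto simp: cl_def)
      then have "\<bar>lam m - lam m0\<bar> < \<nu>" using assms(2,3) by linarith
      then have "cl m = cl m0" using cl_eq m' m0 by blast
      moreover have "\<not> \<bar>lam m\<bar> \<le> \<mu>"
        using gap(1)[OF m0(1)] high m'(2) assms(3) by linarith
      ultimately show "m \<in> {m \<in> \<Lambda>. rep m = v}" using high m' m0 by (simp add: rep_def)
    qed
    then show ?thesis using zero[OF m0(1)] gap(1)[OF m0(1)] high by (simp add: cl_def)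
  qed simp
  have "(\<Sum>m\<in>\<Lambda>. r m * rep m) = (\<Sum>v\<in>rep ` \<Lambda>. \<Sum>m | m \<in> \<Lambda> \<and> rep m = v. r m * rep m)"
    by (rule sum.image_gen[OF fin])
  also have "\<dots> = (\<Sum>v\<in>rep ` \<Lambda>. v * (\<Sum>m | m \<in> \<Lambda> \<and> rep m = v. r m))"
    by (intro sum.cong refl) (simp add: sum_distrib_left mult.commute)
  also have "\<dots> = 0" using fiber by (intro sum.neutral) blast
  finally have "(\<Sum>m\<in>\<Lambda>. r m * lam m) = (\<Sum>m\<in>\<Lambda>. r m * (lam m - rep m))"
    by (simp add: right_diff_distrib sum_subtractf)
  also have "\<bar>\<dots>\<bar> \<le> (\<Sum>m\<in>\<Lambda>. \<bar>r m\<bar> * \<mu>)"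
    by (rule order_trans[OF sum_abs]) (intro sum_mono, simp add: abs_mult near mult_left_mono)
  finally show ?thesis by (simp add: sum_distrib_left mult.commute)
qed

text \<open>Without a sign change the integral of the modulus of \<open>g\<close> is the modulus of
  its integral. The latter is small, since low frequencies give small sines and high ones oscillate.
  It bounds the correlation with frequency \<open>l\<close>, which is the cluster sum times the
  length of the interval, up to errors of the same kind.\<close>

lemma cluster_sum_le_if_no_zero:
  fixes lam r :: "'a \<Rightarrow> real" and g :: "real \<Rightarrow> real"
  assumes fin: "finite \<Lambda>" and "\<alpha> < \<beta>" "0 \<le> \<alpha>" "\<beta> * \<mu> \<le> \<eta>" "0 < \<mu>" "0 < \<nu>"
    and g: "\<And>\<theta>. of_real (g \<theta>) = (\<Sum>m\<in>\<Lambda>. \<i> * of_real (r m) * cis (lam m * \<theta>))"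
    and nz: "\<And>\<theta>. \<alpha> < \<theta> \<Longrightarrow> \<theta> < \<beta> \<Longrightarrow> g \<theta> \<noteq> 0"
    and gap: "\<And>m. m \<in> \<Lambda> \<Longrightarrow> \<bar>lam m\<bar> \<le> \<mu> \<or> \<nu> \<le> \<bar>lam m\<bar>"
      "\<And>m. m \<in> \<Lambda> \<Longrightarrow> \<bar>lam m - l\<bar> \<le> \<mu> \<or> \<nu> \<le> \<bar>lam m - l\<bar>"
  shows "\<bar>\<Sum>m | m \<in> \<Lambda> \<and> \<bar>lam m - l\<bar> \<le> \<mu>. r m\<bar> * (\<beta> - \<alpha>) \<le> 2 * (\<Sum>m\<in>\<Lambda>. \<bar>r m\<bar>) * (\<eta> * (\<beta> - \<alpha>) + 2 / \<nu>)"
proof -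
  define A where "A = (\<Sum>m\<in>\<Lambda>. \<bar>r m\<bar>)"
  have \<eta>: "\<eta> \<ge> 0" using assms(2-5) mult_nonneg_nonneg[of \<beta> \<mu>] by linarith
  have small: "\<bar>b * \<theta>\<bar> \<le> \<eta>" if "\<theta> \<in> {\<alpha>..\<beta>}" "\<bar>b\<bar> \<le> \<mu>" for b \<theta>
  proof -
    have "\<bar>b * \<theta>\<bar> \<le> \<mu> * \<beta>" using that assms(3) by (simp add: abs_mult mult_mono)
    then show ?thesis using assms(4) by (simp add: mult.commute)
  qed
  \<comment> \<open>As \<open>g\<close> is real, only sines survive; this is why frequencies near 0
    contribute little close to the origin.\<close>
  have g': "g \<theta> = (\<Sum>m\<in>\<Lambda>. - r m * sin (lam m * \<theta>))" for \<theta>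
    using arg_cong[OF g[of \<theta>], of Re] by (simp add: Re_sum)
  have contg: "continuous_on {\<alpha>..\<beta>} g" unfolding g' by (intro continuous_intros)
  have sgn: "(\<forall>\<theta>\<in>{\<alpha><..<\<beta>}. g \<theta> > 0) \<or> (\<forall>\<theta>\<in>{\<alpha><..<\<beta>}. g \<theta> < 0)"
  proof (rule ccontr)
    assume "\<not> ?thesis"
    then obtain s t where st: "s \<in> {\<alpha><..<\<beta>}" "t \<in> {\<alpha><..<\<beta>}" "g s \<le> 0" "g t \<ge> 0" by (auto simp: not_less)
    have "connected (g ` {\<alpha><..<\<beta>})"
      by (intro connected_continuous_image continuous_on_subset[OF contg]) auto
    then have "0 \<in> g ` {\<alpha><..<\<beta>}"
      using st unfolding connected_iff_interval by blast
    then show False using nz by auto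
  qed
  have int_abs: "integral {\<alpha>..\<beta>} (\<lambda>\<theta>. \<bar>g \<theta>\<bar>) \<le> \<bar>integral {\<alpha>..\<beta>} g\<bar>"
  proof -
    from sgn obtain \<epsilon> :: real where \<epsilon>: "\<bar>\<epsilon>\<bar> = 1" "\<And>\<theta>. \<theta> \<in> {\<alpha><..<\<beta>} \<Longrightarrow> \<bar>g \<theta>\<bar> = \<epsilon> * g \<theta>"
    proof
      assume "\<forall>\<theta>\<in>{\<alpha><..<\<beta>}. g \<theta> > 0" then show ?thesis using that[of 1] by force
    next
      assume "\<forall>\<theta>\<in>{\<alpha><..<\<beta>}. g \<theta> < 0" then show ?thesis using that[of "-1"] by force
    qed
    \<comment> \<open>The sign is known only in the open interval, so the two endpoints are treated
      as a null set.\<close>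
    have "integral {\<alpha>..\<beta>} (\<lambda>\<theta>. \<bar>g \<theta>\<bar>) = integral {\<alpha>..\<beta>} (\<lambda>\<theta>. \<epsilon> * g \<theta>)"
      by (rule integral_spike[of "{\<alpha>, \<beta>}"]) (use \<epsilon>(2) in \<open>auto simp: less_le\<close>)
    also have "\<dots> = \<epsilon> * integral {\<alpha>..\<beta>} g" by simp
    also have "\<dots> \<le> \<bar>\<epsilon> * integral {\<alpha>..\<beta>} g\<bar>" by simp
    finally show ?thesis using \<epsilon>(1) by (simp add: abs_mult)
  qed
  have int_g: "\<bar>integral {\<alpha>..\<beta>} g\<bar> \<le> A * (\<eta> * (\<beta> - \<alpha>) + 2 / \<nu>)"
  proof -
    have "integral {\<alpha>..\<beta>} g = (\<Sum>m\<in>\<Lambda>. - r m * integral {\<alpha>..\<beta>} (\<lambda>\<theta>. sin (lam m * \<theta>)))"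
      unfolding g' by (subst integral_sum[OF fin]) (auto intro!: integrable_continuous_interval continuous_intros)
    also have "\<bar>\<dots>\<bar> \<le> (\<Sum>m\<in>\<Lambda>. \<bar>r m\<bar> * (\<eta> * (\<beta> - \<alpha>) + 2 / \<nu>))"
    proof (rule order_trans[OF sum_abs], rule sum_mono)
      fix m assume m: "m \<in> \<Lambda>"
      have "\<bar>integral {\<alpha>..\<beta>} (\<lambda>\<theta>. sin (lam m * \<theta>))\<bar> \<le> \<eta> * (\<beta> - \<alpha>) + 2 / \<nu>"
      proof (cases "\<bar>lam m\<bar> \<le> \<mu>")
        case True
        have "norm (integral {\<alpha>..\<beta>} (\<lambda>\<theta>. sin (lam m * \<theta>))) \<le> \<eta> * (\<beta> - \<alpha>)"
        proof (rule integral_bound)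
          fix t assume "t \<in> {\<alpha>..\<beta>}"
          then have "\<bar>lam m * t\<bar> \<le> \<eta>" using small True by blast
          then show "norm (sin (lam m * t)) \<le> \<eta>"
            using abs_sin_x_le_abs_x[of "lam m * t"] by simp
        qed (use assms in \<open>auto intro!: continuous_intros\<close>)
        then show ?thesis using assms(6) by (simp add: add_increasing2)
      next
        case False
        then have "\<nu> \<le> \<bar>lam m\<bar>" using gap(1)[OF m] by auto
        then have 1: "norm (integral {\<alpha>..\<beta>} (\<lambda>\<theta>. cis (lam m * \<theta>))) \<le> 2 / \<nu>"
          using assms by (intro norm_integral_cis_le) auto
        have "integral {\<alpha>..\<beta>} (\<lambda>\<theta>. sin (lam m * \<theta>)) = Im (integral {\<alpha>..\<beta>} (\<lambda>\<theta>. cis (lam m * \<theta>)))"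
          using integral_linear[of "\<lambda>\<theta>. cis (lam m * \<theta>)" "{\<alpha>..\<beta>}" Im] bounded_linear_Im
          by (simp add: o_def integrable_continuous_interval continuous_on_cis_mult)
        then have "\<bar>integral {\<alpha>..\<beta>} (\<lambda>\<theta>. sin (lam m * \<theta>))\<bar> \<le> 2 / \<nu>"
          using 1 abs_Im_le_cmod order_trans by metis
        then show ?thesis using \<eta> assms(2) by (simp add: add_increasing)
      qed
      then show "\<bar>- r m * integral {\<alpha>..\<beta>} (\<lambda>\<theta>. sin (lam m * \<theta>))\<bar> \<le> \<bar>r m\<bar> * (\<eta> * (\<beta> - \<alpha>) + 2 / \<nu>)"
        by (simp add: abs_mult mult_left_mono)
    qed
    also have "\<dots> = A * (\<eta> * (\<beta> - \<alpha>) + 2 / \<nu>)" by (simp add: A_def sum_distrib_right)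
    finally show ?thesis .
  qed
  define I where "I = integral {\<alpha>..\<beta>} (\<lambda>\<theta>. of_real (g \<theta>) * cis (- l * \<theta>))"
  have "norm I \<le> integral {\<alpha>..\<beta>} (\<lambda>\<theta>. \<bar>g \<theta>\<bar>)"
    unfolding I_def
    by (rule integral_norm_bound_integral)
       (auto simp: norm_mult intro!: integrable_continuous_interval continuous_intros contg)
  also note int_abs
  also note int_g
  finally have I_le: "norm I \<le> A * (\<eta> * (\<beta> - \<alpha>) + 2 / \<nu>)" .
  define h where "h m = integral {\<alpha>..\<beta>} (\<lambda>\<theta>. cis ((lam m - l) * \<theta>))" for m
  have "I = integral {\<alpha>..\<beta>} (\<lambda>\<theta>. \<Sum>m\<in>\<Lambda>. \<i> * of_real (r m) * cis ((lam m - l) * \<theta>))"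
    unfolding I_def g by (simp add: sum_distrib_right mult.assoc cis_mult left_diff_distrib)
  also have "\<dots> = (\<Sum>m\<in>\<Lambda>. \<i> * of_real (r m) * h m)"
    unfolding h_def by (subst integral_sum[OF fin]) (auto intro!: integrable_continuous_interval continuous_intros)
  finally have I_eq: "I = (\<Sum>m\<in>\<Lambda>. \<i> * of_real (r m) * h m)" .
  \<comment> \<open>The idealised value of \<open>h m\<close>: frequencies in the cluster act as
    constants, all others as if orthogonal.\<close>
  define near where "near m = (if \<bar>lam m - l\<bar> \<le> \<mu> then of_real (\<beta> - \<alpha>) else 0 :: complex)" for m
  have h_near: "norm (h m - near m) \<le> \<eta> * (\<beta> - \<alpha>) + 2 / \<nu>" if m: "m \<in> \<Lambda>" for m
  proof (cases "\<bar>lam m - l\<bar> \<le> \<mu>")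
    case True
    have "h m - of_real (\<beta> - \<alpha>) = integral {\<alpha>..\<beta>} (\<lambda>\<theta>. cis ((lam m - l) * \<theta>) - 1)"
      using assms(2) unfolding h_def
      by (subst integral_diff) (auto intro!: integrable_continuous_interval continuous_intros simp: scaleR_conv_of_real)
    also have "norm \<dots> \<le> \<eta> * (\<beta> - \<alpha>)"
    proof (rule integral_bound)
      fix t assume "t \<in> {\<alpha>..\<beta>}"
      then have "\<bar>(lam m - l) * t\<bar> \<le> \<eta>" using small True by blast
      moreover have "norm (cis x - 1) \<le> \<bar>x\<bar>" for x
      proof -
        have "cis x - 1 = cis (2 * (x / 2)) - cis (2 * 0)" by simp
        also have "norm \<dots> = 2 * \<bar>sin (x / 2)\<bar>" unfolding cis_diff by (simp add: norm_mult)
        also have "\<dots> \<le> \<bar>x\<bar>" using abs_sin_x_le_abs_x[of "x / 2"] by simp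
        finally show ?thesis .
      qed
      ultimately show "norm (cis ((lam m - l) * t) - 1) \<le> \<eta>" using order_trans by blast
    qed (use assms in \<open>auto intro!: continuous_intros\<close>)
    finally show ?thesis using True assms(6) by (simp add: near_def add_increasing2)
  next
    case False
    then have "\<nu> \<le> \<bar>lam m - l\<bar>" using gap(2)[OF m] by auto
    then have "norm (h m) \<le> 2 / \<nu>"
      unfolding h_def using assms by (intro norm_integral_cis_le) auto
    then show ?thesis using False \<eta> assms(2) by (simp add: near_def add_increasing)
  qed
  have "(\<Sum>m\<in>\<Lambda>. \<i> * of_real (r m) * near m) = \<i> * of_real ((\<Sum>m | m \<in> \<Lambda> \<and> \<bar>lam m - l\<bar> \<le> \<mu>. r m) * (\<beta> - \<alpha>))"
  proof -
    have "(\<Sum>m\<in>\<Lambda>. \<i> * of_real (r m) * near m) = (\<Sum>m\<in>\<Lambda>. if \<bar>lam m - l\<bar> \<le> \<mu> then \<i> * of_real (r m) * of_real (\<beta> - \<alpha>) else 0)"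
      by (rule sum.cong) (auto simp: near_def)
    also have "\<dots> = (\<Sum>m | m \<in> \<Lambda> \<and> \<bar>lam m - l\<bar> \<le> \<mu>. \<i> * of_real (r m) * of_real (\<beta> - \<alpha>))"
      by (rule sum.inter_filter[OF fin, symmetric])
    finally show ?thesis by (simp add: sum_distrib_left sum_distrib_right mult.assoc)
  qed
  then have "\<bar>\<Sum>m | m \<in> \<Lambda> \<and> \<bar>lam m - l\<bar> \<le> \<mu>. r m\<bar> * (\<beta> - \<alpha>) = norm (\<Sum>m\<in>\<Lambda>. \<i> * of_real (r m) * near m)"
    using assms(2) by (simp add: norm_mult abs_mult del: of_real_mult of_real_sum of_real_diff)
  also have "(\<Sum>m\<in>\<Lambda>. \<i> * of_real (r m) * near m) = I - (\<Sum>m\<in>\<Lambda>. \<i> * of_real (r m) * (h m - near m))"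
    by (simp add: I_eq sum_subtractf right_diff_distrib)
  also have "norm \<dots> \<le> norm I + norm (\<Sum>m\<in>\<Lambda>. \<i> * of_real (r m) * (h m - near m))"
    by (rule norm_triangle_ineq4)
  also have "norm (\<Sum>m\<in>\<Lambda>. \<i> * of_real (r m) * (h m - near m)) \<le> (\<Sum>m\<in>\<Lambda>. \<bar>r m\<bar> * (\<eta> * (\<beta> - \<alpha>) + 2 / \<nu>))"
    by (rule sum_norm_le) (use h_near in \<open>auto simp: norm_mult intro!: mult_left_mono\<close>)
  also have "(\<Sum>m\<in>\<Lambda>. \<bar>r m\<bar> * (\<eta> * (\<beta> - \<alpha>) + 2 / \<nu>)) = A * (\<eta> * (\<beta> - \<alpha>) + 2 / \<nu>)"
    by (simp add: A_def sum_distrib_right)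
  finally show ?thesis using I_le unfolding A_def by (simp add: mult.assoc)
qed

section \<open>Bounding the value at 1 when there are few zeros\<close>

lemma poly_pderiv_1: "poly (pderiv q) 1 = (\<Sum>m\<le>degree q. of_nat m * coeff q m)"
  for q :: "complex poly"
proof -
  have "pderiv q = pderiv (\<Sum>m\<le>degree q. monom (coeff q m) m)"
    by (simp only: poly_as_sum_of_monoms)
  then show ?thesis by (simp add: higher_pderiv_sum[of 1, simplified] pderiv_monom poly_sum poly_monom)
qed

lemma coeff_mult_one_minus_monom:
  "coeff ((1 - monom 1 p) * P) m = coeff P m - (if p \<le> m then coeff P (m - p) else 0)"
  for P :: "complex poly"
  by (cases "m < p") (simp_all add: left_diff_distrib coeff_monom_mult)

text \<open>The value at 1 is read off from the first moment of the sparse multiple: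
  \<open>(1 - monom 1 p) * P\<close> vanishes at 1 and has derivative \<open>- p * P(1)\<close>
  there. A large moment forces a high cluster with nonzero sum by
  \<open>clustered_sum_bound\<close>, which contradicts \<open>cluster_sum_le_if_no_zero\<close> on
  a zero-free interval.\<close>

lemma poly_at_1_bounded:
  fixes S :: "real set"
  assumes "finite S" "p \<ge> 1"
  shows "\<exists>H. \<forall>n c. self_reciprocal n c \<longrightarrow> (\<forall>j\<le>n. c j \<in> S) \<longrightarrow>
     card {j. coeff ((1 - monom 1 p) * coeff_poly n c) j \<noteq> 0} \<le> B \<longrightarrow> coeff_poly n c \<noteq> 0 \<longrightarrow>
     card {z. norm z = 1 \<and> poly (coeff_poly n c) z = 0} \<le> k \<longrightarrow> norm (poly (coeff_poly n c) 1) \<le> H"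
proof -
  define D where "D = (\<lambda>(x, y). x - y) ` (insert 0 S \<times> insert 0 S)"
  have D: "finite D" "0 \<in> D" using assms(1) by (auto simp: D_def image_iff)
  obtain R where R: "R \<ge> 0" "\<And>t. t \<in> D \<Longrightarrow> \<bar>t\<bar> \<le> R"
    using finite_imp_bounded[OF D(1)] D(2) unfolding bounded_iff real_norm_def by (metis abs_zero)
  \<comment> \<open>All sums of at most \<open>B\<close> elements of \<open>D\<close>, padded with
    zeros to exactly \<open>B\<close> terms. Finiteness gives a lower bound \<open>\<delta>\<close>
    for nonzero cluster sums.\<close>
  define Sums where "Sums = (\<lambda>w. \<Sum>i<B. w i) ` (PiE {..<B} (\<lambda>_. D))"
  have "finite Sums" unfolding Sums_def using D by (intro finite_imageI finite_PiE) auto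
  then obtain \<delta> where \<delta>: "\<delta> > 0" "\<And>v. v \<in> Sums \<Longrightarrow> v \<noteq> 0 \<Longrightarrow> \<delta> \<le> \<bar>v\<bar>"
    using finite_set_gap[of Sums] by auto
  have Sums: "(\<Sum>m\<in>G. r m) \<in> Sums" if G: "finite G" "card G \<le> B" "\<And>m. m \<in> G \<Longrightarrow> r m \<in> D" for G :: "nat set" and r
  proof -
    obtain b where b: "bij_betw b {0..<card G} G" using ex_bij_betw_nat_finite[OF G(1)] by blast
    have "(\<Sum>m\<in>G. r m) = (\<Sum>i\<in>{0..<card G}. r (b i))"
      by (rule sum.reindex_bij_betw[OF b, symmetric])
    also have "\<dots> = (\<Sum>i<B. if i < card G then r (b i) else 0)"
      by (rule sum.mono_neutral_cong_left) (use G(2) in auto)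
    also have "\<dots> = (\<Sum>i<B. restrict (\<lambda>i. if i < card G then r (b i) else 0) {..<B} i)"
      by (rule sum.cong) auto
    also have "\<dots> \<in> Sums"
      unfolding Sums_def
    proof (rule imageI)
      have "(if i < card G then r (b i) else 0) \<in> D" for i
        using bij_betwE[OF b] G(3) D(2) by simp
      then show "restrict (\<lambda>i. if i < card G then r (b i) else 0) {..<B} \<in> PiE {..<B} (\<lambda>_. D)"
        by (simp only: restrict_PiE_iff) blast
    qed
    finally show ?thesis .
  qed
  define A where "A = real B * R + 1"
  have A: "A > 0" using R(1) by (simp add: A_def add_nonneg_pos)
  \<comment> \<open>The first bound keeps \<open>p * \<theta>\<close> below \<open>pi\<close> for
    \<open>\<theta>\<close> up to \<open>\<eta>\<close>; the second limits the low-frequency error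
    to a quarter of \<open>\<delta>\<close>.\<close>
  define \<eta> where "\<eta> = min (1 / real p) (\<delta> / (8 * A))"
  have \<eta>: "\<eta> > 0" "\<eta> \<le> 1 / real p" "\<eta> \<le> \<delta> / (8 * A)"
    using \<delta>(1) A assms(2) by (auto simp: \<eta>_def)
  have \<eta>1: "\<eta> \<le> 1" "real p * \<eta> \<le> 1"
  proof -
    have "1 / real p \<le> 1" using assms(2) by simp
    then show "\<eta> \<le> 1" using \<eta>(2) by linarith
    show "real p * \<eta> \<le> 1" using \<eta>(2) assms(2) by (simp add: field_simps)
  qed
  \<comment> \<open>The 3 separates clusters, as \<open>2 * \<mu> < \<nu>\<close> requires; the
    other term makes the oscillation error \<open>4 * A / \<nu>\<close> at most
    \<open>\<delta> / 4 * w\<close>.\<close>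
  define \<Gamma> where "\<Gamma> = max 3 (16 * A * real (k + 1) / (\<eta> * \<delta>))"
  have \<Gamma>: "\<Gamma> \<ge> 3" "16 * A * real (k + 1) / (\<eta> * \<delta>) \<le> \<Gamma>" by (auto simp: \<Gamma>_def)
  \<comment> \<open>The exponent counts the moduli of the frequencies and of their differences,
    which the scale has to avoid.\<close>
  define H where "H = \<Gamma> ^ (B + B * B) * A"
  have "norm (poly P 1) \<le> H"
    if sr: "self_reciprocal n c" and cS: "\<And>j. j \<le> n \<Longrightarrow> c j \<in> S" and P: "P = coeff_poly n c"
      and cardB: "card {j. coeff ((1 - monom 1 p) * P) j \<noteq> 0} \<le> B" and P0: "P \<noteq> 0"
      and cardk: "card {z. norm z = 1 \<and> poly P z = 0} \<le> k" for n c P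
  proof (rule ccontr)
    assume big: "\<not> norm (poly P 1) \<le> H"
    define Rp where "Rp = (1 - monom 1 p) * P"
    define \<Lambda> where "\<Lambda> = {j. coeff Rp j \<noteq> 0}"
    have fin: "finite \<Lambda>" by (simp add: \<Lambda>_def finite_supp)
    have card\<Lambda>: "card \<Lambda> \<le> B" using cardB by (simp add: \<Lambda>_def Rp_def)
    define c' where "c' m = (if m \<le> n then c m else 0)" for m
    define r where "r m = c' m - (if p \<le> m then c' (m - p) else 0)" for m
    have c': "c' m \<in> insert 0 S" for m using cS by (auto simp: c'_def)
    have rD: "r m \<in> D" for m
      unfolding D_def r_def using c' by (intro image_eqI[of _ _ "(c' m, if p \<le> m then c' (m - p) else 0)"]) auto
    have cR: "coeff Rp m = of_real (r m)" for m
      by (simp add: Rp_def coeff_mult_one_minus_monom P coeff_coeff_poly r_def c'_def)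
    have sum_r: "(\<Sum>m\<in>\<Lambda>. \<bar>r m\<bar>) \<le> A"
    proof -
      have "(\<Sum>m\<in>\<Lambda>. \<bar>r m\<bar>) \<le> (\<Sum>m\<in>\<Lambda>. R)" using R(2)[OF rD] by (intro sum_mono) auto
      also have "\<dots> \<le> real B * R" using card\<Lambda> R(1) by (simp add: mult_right_mono)
      finally show ?thesis by (simp add: A_def)
    qed
    \<comment> \<open>Frequencies in the half angle, centred at the middle of the formal degree
      \<open>n + p\<close>.\<close>
    define lam where "lam m = 2 * real m - real n - real p" for m
    define V where "V = (\<lambda>m. \<bar>lam m\<bar>) ` \<Lambda> \<union> (\<lambda>(m, m'). \<bar>lam m - lam m'\<bar>) ` (\<Lambda> \<times> \<Lambda>)"
    have "card V \<le> card ((\<lambda>m. \<bar>lam m\<bar>) ` \<Lambda>) + card ((\<lambda>(m, m'). \<bar>lam m - lam m'\<bar>) ` (\<Lambda> \<times> \<Lambda>))"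
      unfolding V_def by (rule card_Un_le)
    also have "\<dots> \<le> card \<Lambda> + card (\<Lambda> \<times> \<Lambda>)"
      by (intro add_mono card_image_le) (use fin in auto)
    also have "\<dots> \<le> B + B * B"
      using card\<Lambda> by (simp add: card_cartesian_product add_mono mult_mono)
    finally have "card V \<le> B + B * B" .
    moreover have "finite V" using fin by (simp add: V_def)
    ultimately obtain i where i: "i \<le> B + B * B" "\<And>v. v \<in> V \<Longrightarrow> v \<le> \<Gamma> ^ i \<or> \<Gamma> ^ Suc i \<le> v"
      using gap_between_powers[of V "B + B * B" \<Gamma>] \<Gamma>(1) by auto
    define \<mu> \<nu> where "\<mu> = \<Gamma> ^ i" and "\<nu> = \<Gamma> ^ Suc i"
    have \<mu>1: "\<mu> \<ge> 1" using \<Gamma>(1) by (simp add: \<mu>_def)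
    have \<nu>\<mu>: "\<nu> = \<Gamma> * \<mu>" by (simp add: \<mu>_def \<nu>_def)
    then have "3 * \<mu> \<le> \<nu>" using \<Gamma>(1) \<mu>1 by (simp add: mult_right_mono)
    then have \<nu>: "2 * \<mu> < \<nu>" "\<nu> > 0" using \<mu>1 by auto
    have gap1: "\<bar>lam m\<bar> \<le> \<mu> \<or> \<nu> \<le> \<bar>lam m\<bar>" if "m \<in> \<Lambda>" for m
      using i(2)[of "\<bar>lam m\<bar>"] that by (auto simp: V_def \<mu>_def \<nu>_def)
    have gap2: "\<bar>lam m - lam m'\<bar> \<le> \<mu> \<or> \<nu> \<le> \<bar>lam m - lam m'\<bar>" if "m \<in> \<Lambda>" "m' \<in> \<Lambda>" for m m'
    proof -
      have "\<bar>lam m - lam m'\<bar> \<in> V"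
        unfolding V_def by (intro UnI2 image_eqI[of _ _ "(m, m')"]) (use that in auto)
      then show ?thesis using i(2) unfolding \<mu>_def \<nu>_def by blast
    qed
    have \<Lambda>deg: "\<Lambda> \<subseteq> {..degree Rp}" by (auto simp: \<Lambda>_def intro: le_degree)
    \<comment> \<open>The centring term drops out because the coefficients of \<open>Rp\<close> sum
      to 0.\<close>
    have moment: "of_real (\<Sum>m\<in>\<Lambda>. r m * lam m) = - of_nat (2 * p) * poly P 1"
    proof -
      have "poly Rp 1 = (\<Sum>m\<in>\<Lambda>. of_real (r m))"
        unfolding poly_altdef cR[symmetric]
        by (rule sum.mono_neutral_cong_right) (use \<Lambda>deg in \<open>auto simp: \<Lambda>_def\<close>)
      moreover have "poly Rp 1 = 0" by (simp add: Rp_def poly_monom)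
      ultimately have s0: "(\<Sum>m\<in>\<Lambda>. complex_of_real (r m)) = 0" by simp
      have "poly (pderiv Rp) 1 = (\<Sum>m\<in>\<Lambda>. of_nat m * of_real (r m))"
        unfolding poly_pderiv_1 cR[symmetric]
        by (rule sum.mono_neutral_cong_right) (use \<Lambda>deg in \<open>auto simp: \<Lambda>_def\<close>)
      moreover have "poly (pderiv Rp) 1 = - of_nat p * poly P 1"
        by (simp add: Rp_def pderiv_mult pderiv_diff pderiv_monom poly_monom)
      ultimately have s1: "(\<Sum>m\<in>\<Lambda>. of_nat m * complex_of_real (r m)) = - of_nat p * poly P 1" by simp
      have "complex_of_real (\<Sum>m\<in>\<Lambda>. r m * lam m) = (\<Sum>m\<in>\<Lambda>. 2 * (of_nat m * of_real (r m)) - of_nat (n + p) * of_real (r m))"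
        by (simp add: lam_def algebra_simps)
      also have "\<dots> = 2 * (\<Sum>m\<in>\<Lambda>. of_nat m * of_real (r m)) - of_nat (n + p) * (\<Sum>m\<in>\<Lambda>. of_real (r m))"
        by (simp only: sum_subtractf sum_distrib_left)
      finally show ?thesis by (simp add: s0 s1)
    qed
    have "\<exists>m0\<in>\<Lambda>. \<nu> \<le> \<bar>lam m0\<bar> \<and> (\<Sum>m | m \<in> \<Lambda> \<and> \<bar>lam m - lam m0\<bar> \<le> \<mu>. r m) \<noteq> 0"
    proof (rule ccontr)
      assume "\<not> ?thesis"
      then have "\<bar>\<Sum>m\<in>\<Lambda>. r m * lam m\<bar> \<le> \<mu> * (\<Sum>m\<in>\<Lambda>. \<bar>r m\<bar>)"
        using \<mu>1 \<nu> gap1 gap2 by (intro clustered_sum_bound[OF fin]) auto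
      also have "\<dots> \<le> \<Gamma> ^ (B + B * B) * A"
        using sum_r \<mu>1 \<Gamma>(1) i(1) by (intro mult_mono) (auto simp: \<mu>_def power_increasing sum_nonneg)
      finally have "norm (complex_of_real (\<Sum>m\<in>\<Lambda>. r m * lam m)) \<le> H"
        by (simp only: norm_of_real H_def)
      then have "real (2 * p) * norm (poly P 1) \<le> H" unfolding moment by (simp add: norm_mult)
      moreover have "1 * norm (poly P 1) \<le> real (2 * p) * norm (poly P 1)"
        using assms(2) by (intro mult_right_mono) auto
      ultimately show False using big by simp
    qed
    then obtain m0 where m0: "m0 \<in> \<Lambda>" and \<sigma>0: "(\<Sum>m | m \<in> \<Lambda> \<and> \<bar>lam m - lam m0\<bar> \<le> \<mu>. r m) \<noteq> 0" by blast
    define \<sigma> where "\<sigma> = (\<Sum>m | m \<in> \<Lambda> \<and> \<bar>lam m - lam m0\<bar> \<le> \<mu>. r m)"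
    have "\<sigma> \<in> Sums" unfolding \<sigma>_def
    proof (rule Sums)
      have "card {m \<in> \<Lambda>. \<bar>lam m - lam m0\<bar> \<le> \<mu>} \<le> card \<Lambda>" by (intro card_mono fin) auto
      then show "card {m \<in> \<Lambda>. \<bar>lam m - lam m0\<bar> \<le> \<mu>} \<le> B" using card\<Lambda> by simp
    qed (use fin rD in auto)
    then have \<sigma>\<delta>: "\<delta> \<le> \<bar>\<sigma>\<bar>" using \<delta>(2) \<sigma>0 by (simp add: \<sigma>_def)
    \<comment> \<open>Up to phase this is \<open>Rp\<close> at \<open>cis (2 * \<theta>)\<close>,
      the sine coming from the factor \<open>1 - monom 1 p\<close>.\<close>
    define g where "g \<theta> = 2 * sin (real p * \<theta>) * cos_sum n c \<theta>" for \<theta>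
    have g: "of_real (g \<theta>) = (\<Sum>m\<in>\<Lambda>. \<i> * of_real (r m) * cis (lam m * \<theta>))" for \<theta>
    proof -
      have "(\<Sum>m\<in>\<Lambda>. \<i> * of_real (r m) * cis (lam m * \<theta>)) = (\<Sum>m\<in>\<Lambda>. \<i> * cis (- (real n + real p) * \<theta>) * (of_real (r m) * cis (2 * \<theta>) ^ m))"
      proof (rule sum.cong[OF refl])
        fix m
        have "cis (lam m * \<theta>) = cis (- (real n + real p) * \<theta>) * cis (2 * \<theta>) ^ m"
          unfolding Complex.DeMoivre cis_mult by (rule arg_cong[of _ _ cis]) (simp add: lam_def algebra_simps)
        then show "\<i> * of_real (r m) * cis (lam m * \<theta>) = \<i> * cis (- (real n + real p) * \<theta>) * (of_real (r m) * cis (2 * \<theta>) ^ m)"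
          by (simp only: mult_ac)
      qed
      also have "\<dots> = \<i> * cis (- (real n + real p) * \<theta>) * poly Rp (cis (2 * \<theta>))"
        unfolding sum_distrib_left[symmetric] poly_altdef cR[symmetric]
        by (intro arg_cong[of _ _ "(*) _"] sum.mono_neutral_cong_left) (use \<Lambda>deg in \<open>auto simp: \<Lambda>_def\<close>)
      also have "poly Rp (cis (2 * \<theta>)) = - (cis (2 * (real p * \<theta>)) - cis (2 * 0)) * (cis (real n * \<theta>) * of_real (cos_sum n c \<theta>))"
      proof -
        have "cis (2 * \<theta>) ^ p = cis (2 * (real p * \<theta>))"
          unfolding Complex.DeMoivre by (simp add: mult_ac)
        then show ?thesis
          unfolding Rp_def poly_mult P poly_coeff_poly_cis[OF sr] by (simp add: poly_monom)
      qed
      also have "\<i> * cis (- (real n + real p) * \<theta>) * \<dots> = (cis (- (real n + real p) * \<theta>) * (cis (real p * \<theta>) * cis (real n * \<theta>))) * of_real (g \<theta>)"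
        unfolding cis_diff g_def by simp
      also have "cis (- (real n + real p) * \<theta>) * (cis (real p * \<theta>) * cis (real n * \<theta>)) = 1"
        unfolding cis_mult by (simp add: algebra_simps)
      finally show ?thesis by simp
    qed
    \<comment> \<open>Then \<open>k + 1\<close> adjacent intervals of length \<open>w\<close> fill
      the range up to \<open>\<eta> / \<mu>\<close>, in which frequencies up to \<open>\<mu>\<close>
      have phase at most \<open>\<eta>\<close>.\<close>
    define w where "w = \<eta> / (\<mu> * real (k + 1))"
    have w: "w > 0" using \<eta> \<mu>1 by (simp add: w_def)
    have wk: "w * real (k + 1) * \<mu> = \<eta>"
    proof -
      have "\<mu> * real (k + 1) \<noteq> 0" using \<mu>1 by simp
      then have "w * (\<mu> * real (k + 1)) = \<eta>"
        unfolding w_def by (metis nonzero_eq_divide_eq)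
      then show ?thesis by (simp only: mult_ac)
    qed
    have upper: "real (j + 1) * w * \<mu> \<le> \<eta>" if "j \<le> k" for j
    proof -
      have "real (j + 1) * w * \<mu> \<le> real (k + 1) * w * \<mu>"
        using that w \<mu>1 by (intro mult_right_mono) auto
      then show ?thesis using wk by (simp add: mult_ac)
    qed
    \<comment> \<open>On these intervals \<open>sin (p * \<theta>)\<close> is positive, so a zero of
      \<open>g\<close> in each would give \<open>k + 1\<close> distinct unimodular zeros of
      \<open>P\<close>.\<close>
    have "\<exists>j\<le>k. \<forall>\<theta>. real j * w < \<theta> \<and> \<theta> < real (j + 1) * w \<longrightarrow> g \<theta> \<noteq> 0"
    proof (rule ccontr)
      assume "\<not> ?thesis"
      then have "\<forall>j. \<exists>\<theta>. j \<le> k \<longrightarrow> real j * w < \<theta> \<and> \<theta> < real (j + 1) * w \<and> g \<theta> = 0" by blast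
      then obtain \<theta> where \<theta>: "\<And>j. j \<le> k \<Longrightarrow> real j * w < \<theta> j \<and> \<theta> j < real (j + 1) * w \<and> g (\<theta> j) = 0"
        by metis
      have range: "0 < \<theta> j" "\<theta> j < \<eta>" if "j \<le> k" for j
      proof -
        have "0 \<le> real j * w" using w by simp
        then show "0 < \<theta> j" using \<theta>[OF that] by linarith
        have "real (j + 1) * w \<le> real (j + 1) * w * \<mu>" using w \<mu>1 by simp
        then show "\<theta> j < \<eta>" using \<theta>[OF that] upper[OF that] by linarith
      qed
      have zero: "poly P (cis (2 * \<theta> j)) = 0" if "j \<le> k" for j
      proof -
        have "real p * \<theta> j < real p * \<eta>" using range[OF that] assms(2) by simp
        then have "real p * \<theta> j < pi" using \<eta>1(2) pi_gt3 by linarith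
        moreover have "0 < real p * \<theta> j" using range[OF that] assms(2) by simp
        ultimately have "sin (real p * \<theta> j) > 0" by (intro sin_gt_zero)
        then have "cos_sum n c (\<theta> j) = 0" using \<theta>[OF that] by (simp add: g_def)
        then show ?thesis unfolding P poly_coeff_poly_cis[OF sr] by simp
      qed
      have less: "\<theta> i < \<theta> j" if "i < j" "j \<le> k" for i j
      proof -
        have "\<theta> i < real (i + 1) * w" using \<theta>[of i] that by simp
        also have "\<dots> \<le> real j * w" using that w by (intro mult_right_mono) auto
        also have "\<dots> < \<theta> j" using \<theta>[of j] that by simp
        finally show ?thesis .
      qed
      have neq: "cis (2 * \<theta> i) \<noteq> cis (2 * \<theta> j)" if "i < j" "j \<le> k" for i j
      proof
        assume "cis (2 * \<theta> i) = cis (2 * \<theta> j)"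
        then have "sin (\<theta> j - \<theta> i) = 0" using cis_diff[of "\<theta> j" "\<theta> i"] by simp
        moreover have "0 < \<theta> j - \<theta> i" "\<theta> j - \<theta> i < pi"
          using less[OF that] range[of i] range[of j] that \<eta>1(1) pi_gt3 by auto
        ultimately show False using sin_gt_zero[of "\<theta> j - \<theta> i"] by simp
      qed
      have "inj_on (\<lambda>j. cis (2 * \<theta> j)) {..k}"
        by (rule inj_onI) (metis atMost_iff neq linorder_neqE_nat)
      then have "card {..k} \<le> card {z. norm z = 1 \<and> poly P z = 0}"
        using zero poly_roots_finite[OF P0] by (intro card_inj_on_le[of "\<lambda>j. cis (2 * \<theta> j)"]) auto
      then show False using cardk by simp
    qed
    then obtain j where j: "j \<le> k" "\<And>\<theta>. real j * w < \<theta> \<Longrightarrow> \<theta> < real (j + 1) * w \<Longrightarrow> g \<theta> \<noteq> 0" by blast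
    have len: "real (j + 1) * w - real j * w = w" by (simp add: algebra_simps)
    have "\<bar>\<sigma>\<bar> * (real (j + 1) * w - real j * w) \<le> 2 * (\<Sum>m\<in>\<Lambda>. \<bar>r m\<bar>) * (\<eta> * (real (j + 1) * w - real j * w) + 2 / \<nu>)"
      unfolding \<sigma>_def
      by (rule cluster_sum_le_if_no_zero[OF fin _ _ upper[OF j(1)] _ \<nu>(2) g j(2)])
         (use w \<mu>1 gap1 gap2 m0 in auto)
    then have "\<bar>\<sigma>\<bar> * w \<le> 2 * (\<Sum>m\<in>\<Lambda>. \<bar>r m\<bar>) * (\<eta> * w + 2 / \<nu>)" unfolding len .
    also have "\<dots> \<le> 2 * A * (\<eta> * w + 2 / \<nu>)"
      using sum_r \<eta> w \<nu> by (intro mult_right_mono) auto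
    also have "\<dots> = 2 * A * \<eta> * w + 4 * A / \<nu>" by (simp add: algebra_simps)
    also have "\<dots> \<le> \<delta> / 4 * w + \<delta> / 4 * w"
    proof (rule add_mono)
      have "2 * A * \<eta> \<le> \<delta> / 4" using \<eta>(3) A by (simp add: field_simps)
      then show "2 * A * \<eta> * w \<le> \<delta> / 4 * w" using w by (intro mult_right_mono) auto
      have "16 * A * real (k + 1) \<le> \<Gamma> * (\<eta> * \<delta>)"
        using \<Gamma>(2) \<eta>(1) \<delta>(1) by (simp add: divide_le_eq)
      also have "\<Gamma> * (\<eta> * \<delta>) = 4 * ((\<delta> / 4 * w * \<nu>) * real (k + 1))"
        unfolding \<nu>\<mu> by (subst wk[symmetric]) (simp add: mult_ac)
      finally have "4 * A * real (k + 1) \<le> (\<delta> / 4 * w * \<nu>) * real (k + 1)" by linarith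
      then have "4 * A \<le> \<delta> / 4 * w * \<nu>" by (rule mult_right_le_imp_le) simp
      then show "4 * A / \<nu> \<le> \<delta> / 4 * w"
        using \<nu>(2) by (simp add: divide_le_eq)
    qed
    also have "\<dots> < \<delta> * w" using \<delta>(1) w by simp
    also have "\<dots> \<le> \<bar>\<sigma>\<bar> * w" using \<sigma>\<delta> w by (intro mult_right_mono) auto
    finally show False by simp
  qed
  then show ?thesis by blast
qed

section \<open>Deduction of the theorem by contradiction along a subsequence\<close>

theorem corollary2p3:
  fixes S :: "real set" and a :: "nat \<Rightarrow> nat \<Rightarrow> real" and P :: "nat \<Rightarrow> complex poly"
  assumes "finite S"
    and "\<And>n. n \<ge> 1 \<Longrightarrow> P n = coeff_poly n (\<lambda>j. a j n)"
    and "\<And>n j. n \<ge> 1 \<Longrightarrow> j \<le> n \<Longrightarrow> a j n \<in> S"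
    and "\<And>n. n \<ge> 1 \<Longrightarrow> self_reciprocal n (\<lambda>j. a j n)"
    and "filterlim (\<lambda>n. norm (poly (P n) 1)) at_top sequentially"
  shows "(\<lambda>n. NZ (P n)) \<longlonglongrightarrow> \<infinity>"
proof -
  have "eventually (\<lambda>n. enat k < NZ (P n)) sequentially" for k
  proof (rule ccontr)
    assume *: "\<not> ?thesis"
    define X where "X = {n. n \<ge> 1 \<and> NZ (P n) \<le> enat k}"
    have "infinite X"
    proof
      assume "finite X"
      then obtain N where N: "\<And>n. n \<in> X \<Longrightarrow> n \<le> N"
        using finite_nat_set_iff_bounded_le by auto
      have "enat k < NZ (P n)" if "n \<ge> Suc N" for n
        using N[of n] that by (auto simp: X_def not_le[symmetric])
      then have "eventually (\<lambda>n. enat k < NZ (P n)) sequentially"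
        unfolding eventually_sequentially by blast
      with * show False by blast
    qed
    then obtain h :: "nat \<Rightarrow> nat" where h: "strict_mono h" "\<And>i. h i \<in> X"
      using infinite_enumerate by blast
    have h1: "h i \<ge> 1" for i using h(2)[of i] by (simp add: X_def)
    \<comment> \<open>The zero polynomial is excluded because its count is infinite.\<close>
    have P0: "P (h i) \<noteq> 0" and ord: "(\<Sum>z | norm z = 1 \<and> poly (P (h i)) z = 0. order z (P (h i))) \<le> k" for i
      using h(2)[of i] by (auto simp: X_def NZ_def split: if_splits)
    \<comment> \<open>Zero is added for the coefficients beyond index \<open>n\<close>.\<close>
    define T where "T = complex_of_real ` insert 0 S"
    have T: "finite T" using assms(1) by (simp add: T_def)
    have coeffT: "coeff (P (h i)) j \<in> T" for i j
      using assms(2)[OF h1[of i]] assms(3)[OF h1[of i], of j] by (auto simp: coeff_coeff_poly T_def)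
    have ex: "\<exists>Q \<kappa> M. lead_coeff Q = 1 \<and> degree Q \<le> k
     \<and> (\<forall>z. norm z = 1 \<longrightarrow> norm (poly Q z) \<le> 2 ^ degree Q) \<and> norm \<kappa> = 1
     \<and> (\<forall>z. norm z = 1 \<longrightarrow> poly (P (h i) * Q) z = \<kappa> * z ^ M * of_real (norm (poly (P (h i) * Q) z)))" for i
      using constant_phase[OF P0[of i], of "h i" "cos_sum (h i) (\<lambda>j. a j (h i))"]
        poly_coeff_poly_cis[OF assms(4)[OF h1[of i]]] assms(2)[OF h1[of i]] ord[of i] by metis
    obtain Q B g where g: "strict_mono (g :: nat \<Rightarrow> nat)" and Q: "lead_coeff Q = 1"
      and B: "\<And>i. card {j. coeff (P (h (g i)) * Q) j \<noteq> 0} \<le> B"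
      using sparse_multiple[OF T, of "\<lambda>i. P (h i)" k, OF coeffT ex] by blast
    obtain p c where p: "p \<ge> 1" and pc: "\<And>p'. (\<forall>j. coeff p' j \<in> T) \<Longrightarrow>
     card {j. coeff ((1 - monom 1 p) * p') j \<noteq> 0} \<le> p + card {j. coeff (p' * Q) j \<noteq> 0} * c"
      using sparse_periodic[OF T Q] by blast
    obtain H where H: "\<And>n c'. self_reciprocal n c' \<Longrightarrow> (\<forall>j\<le>n. c' j \<in> S) \<Longrightarrow>
     card {j. coeff ((1 - monom 1 p) * coeff_poly n c') j \<noteq> 0} \<le> p + B * c \<Longrightarrow> coeff_poly n c' \<noteq> 0 \<Longrightarrow>
     card {z. norm z = 1 \<and> poly (coeff_poly n c') z = 0} \<le> k \<Longrightarrow> norm (poly (coeff_poly n c') 1) \<le> H"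
      using poly_at_1_bounded[OF assms(1) p, of "p + B * c" k] by blast
    have bound: "norm (poly (P (h (g i))) 1) \<le> H" for i
    proof -
      define n where "n = h (g i)"
      have n: "n \<ge> 1" and Pn: "P n = coeff_poly n (\<lambda>j. a j n)" using h1 assms(2) by (auto simp: n_def)
      \<comment> \<open>Passing from multiplicities to distinct zeros: every zero has order at least
        1.\<close>
      have "card {z. norm z = 1 \<and> poly (P n) z = 0} = (\<Sum>z | norm z = 1 \<and> poly (P n) z = 0. 1)" by simp
      also have "\<dots> \<le> (\<Sum>z | norm z = 1 \<and> poly (P n) z = 0. order z (P n))"
        using P0[of "g i"] by (intro sum_mono) (auto simp: n_def order_root Suc_le_eq)
      also have "\<dots> \<le> k" using ord[of "g i"] by (simp add: n_def)
      finally have "card {z. norm z = 1 \<and> poly (P n) z = 0} \<le> k" .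
      moreover have "card {j. coeff ((1 - monom 1 p) * P n) j \<noteq> 0} \<le> p + B * c"
      proof -
        have "card {j. coeff ((1 - monom 1 p) * P n) j \<noteq> 0} \<le> p + card {j. coeff (P n * Q) j \<noteq> 0} * c"
          using coeffT[of "g i"] by (intro pc) (simp add: n_def)
        also have "\<dots> \<le> p + B * c" unfolding n_def by (intro add_left_mono mult_le_mono1 B)
        finally show ?thesis .
      qed
      ultimately show ?thesis
        using H[of n "\<lambda>j. a j n"] assms(3)[OF n] assms(4)[OF n] P0[of "g i"] by (simp add: Pn[symmetric] flip: n_def)
    qed
    have "eventually (\<lambda>n. H < norm (poly (P n) 1)) sequentially"
      using assms(5) by (simp add: filterlim_at_top_dense)
    then obtain N where N: "\<And>n. n \<ge> N \<Longrightarrow> H < norm (poly (P n) 1)"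
      unfolding eventually_sequentially by blast
    have "N \<le> h (g N)"
      using seq_suble[OF strict_mono_o[OF h(1) g], of N] by simp
    then show False using N[of "h (g N)"] bound[of N] by simp
  qed
  then show ?thesis
    by (intro order_tendstoI) (auto simp: less_infinityE elim!: less_infinityE)
qed

end
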